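(* Let $\nu\ge0$, $\alpha,\beta>0$, and let $f\in C^\infty(0,\infty)$ have support $[a,b]$ with $0<a<b<\infty$. Then the fractional Bessel integral and the fractional Bessel derivative on the semiaxis satisfy the semigroup property (on $(0,\infty)$) $$ IB_{\nu,-}^{\alpha}\,IB_{\nu,-}^{\beta}f=IB_{\nu,-}^{\alpha+\beta}f, $$ $$ DB_{\nu,-}^{\alpha}\,DB_{\nu,-}^{\beta}f=DB_{\nu,-}^{\alpha+\beta}f. $$
   Context: For $\nu\ge 0$ the Bessel operator on $(0,\infty)$ is $B_\nu=D^2+\frac{\nu}{x}D$, $D=\frac{d}{dx}$. For $\alpha>0$ the fractional Bessel integral on the semiaxis $(0,\infty)$ (also written $B_{\nu,-}^{-\alpha}$) is $$ (IB_{\nu,-}^{\alpha}f)(x)=\frac{1}{\Gamma(2\alpha)}\int_x^{+\infty}\left(\frac{y^2-x^2}{2y}\right)^{2\alpha-1}{}_2F_1\left(\alpha+\frac{\nu-1}{2},\alpha;2\alpha;1-\frac{x^2}{y^2}\right)f(y)\,dy,\qquad x>0, $$ where ${}_2F_1$ is the Gauss hypergeometric function. The fractional Bessel derivative on the semiaxis is $$ (DB_{\nu,-}^{\alpha}f)(x)=B_\nu^n\,(IB_{\nu,-}^{n-\alpha}f)(x),\qquad \alpha>0, $$ where $n$ is a positive integer with $n>\alpha$ (for each order an integer larger than that order is used). The same formulas are used to apply these operators to smooth functions on $(0,\infty)$ that vanish for all sufficiently large $x$. *)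

theory Defs
  imports "HOL-Analysis.Analysis"
begin

definition smooth_on_halfline :: "(real \<Rightarrow> real) \<Rightarrow> bool" where
  "smooth_on_halfline f \<longleftrightarrow> (\<forall>k. \<forall>x>0. ((deriv ^^ k) f) field_differentiable (at x))"

(* The power series has radius of convergence at least 1 whenever c is not a nonpositive
   integer; below it is only evaluated with c > 0 and 0 <= z < 1. *)
definition hypergeo_2F1 :: "real \<Rightarrow> real \<Rightarrow> real \<Rightarrow> real \<Rightarrow> real" where
  "hypergeo_2F1 a b c z = eval_fps (fps_hypergeo [a, b] [c] 1) z"

definition bessel_op :: "real \<Rightarrow> (real \<Rightarrow> real) \<Rightarrow> real \<Rightarrow> real" where
  "bessel_op \<nu> f = (\<lambda>x. deriv (deriv f) x + \<nu> / x * deriv f x)"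

definition bessel_frac_integral :: "real \<Rightarrow> real \<Rightarrow> (real \<Rightarrow> real) \<Rightarrow> real \<Rightarrow> real" where
  "bessel_frac_integral \<nu> \<alpha> f = (\<lambda>x. 1 / Gamma (2 * \<alpha>) *
     (LBINT y:{x<..}. ((y\<^sup>2 - x\<^sup>2) / (2 * y)) powr (2 * \<alpha> - 1) *
        hypergeo_2F1 (\<alpha> + (\<nu> - 1) / 2) \<alpha> (2 * \<alpha>) (1 - x\<^sup>2 / y\<^sup>2) * f y))"

(* The auxiliary integer n > \<alpha> is an explicit argument: which one is chosen is not part of
   the notation of the derivative, so statements quantify over all admissible n. *)
definition bessel_frac_deriv :: "real \<Rightarrow> nat \<Rightarrow> real \<Rightarrow> (real \<Rightarrow> real) \<Rightarrow> real \<Rightarrow> real" where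
  "bessel_frac_deriv \<nu> n \<alpha> f = (bessel_op \<nu> ^^ n) (bessel_frac_integral \<nu> (real n - \<alpha>) f)"

end

theory Submission
  imports Defs
begin

text \<open>
  Put \<open>\<eta> = (\<nu> - 1) / 2\<close> and \<open>t = x\<^sup>2\<close>. Then \<open>B = 4 t\<^bsup>-\<eta>\<^esup> D t\<^bsup>\<eta>+1\<^esup> D\<close>, and the fractional integral factors as
  \<open>4\<^bsup>-\<alpha>\<^esup> J\<^sup>\<alpha> t\<^bsup>-\<eta>-\<alpha>\<^esup> J\<^sup>\<alpha> t\<^sup>\<eta>\<close>, where \<open>J\<^sup>\<alpha>\<close> is the right-sided Riemann--Liouville integral; this
  factorisation is Euler's integral for \<open>2F1\<close>. The operators \<open>K\<^sub>a\<^sup>\<alpha> = t\<^sup>a J\<^sup>\<alpha> t\<^bsup>-\<alpha>-a\<^esup>\<close> commute with dilations,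
  so in logarithmic coordinates they are convolutions: they commute with each other, and the Beta integral
  gives \<open>K\<^sub>a\<^sup>\<alpha> K\<^bsub>a+\<alpha>\<^esub>\<^sup>\<beta> = K\<^sub>a\<^bsup>\<alpha>+\<beta>\<^esup>\<close>. Since the fractional integral is \<open>4\<^bsup>-\<alpha>\<^esup> K\<^bsub>-\<eta>\<^esub>\<^sup>\<alpha> K\<^sub>0\<^sup>\<alpha> t\<^sup>\<alpha>\<close>, its
  semigroup law follows.

  For the derivatives, \<open>I\<^sup>1 B f = f\<close> and \<open>B I\<^sup>1 g = g\<close> by the fundamental theorem of calculus. Hence
  \<open>I\<^sup>\<alpha> f = I\<^sup>\<alpha> I\<^sup>1 B f = I\<^sup>1 I\<^sup>\<alpha> B f\<close>, and applying \<open>B\<close> gives \<open>B I\<^sup>\<alpha> f = I\<^sup>\<alpha> B f\<close> without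
  differentiating under the integral sign.
\<close>

section \<open>Euler's integral\<close>


lemma hypergeo_2F1_altdef:
  "hypergeo_2F1 a b c z = (\<Sum>n. pochhammer a n * pochhammer b n / (pochhammer c n * fact n) * z ^ n)"
  by (simp add: hypergeo_2F1_def eval_fps_def)

text \<open>Every coefficient past n = 0 contains the factor 0. This degenerate case arises when two
  kernels of matching index are composed.\<close>

lemma hypergeo_2F1_0_left: "hypergeo_2F1 0 b c z = 1"
proof -
  have "hypergeo_2F1 0 b c z = (\<Sum>n. if n = 0 then 1 else 0)"
    unfolding hypergeo_2F1_altdef by (intro suminf_cong) (auto simp: pochhammer_0_left)
  then show ?thesis using sums_unique[OF sums_single[of 0 "\<lambda>_. 1::real"]] by simp
qed

text \<open>A \<open>suminf\<close> of measurable terms is measurable even where the series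
  diverges, so z ranges over all reals here.\<close>

lemma borel_measurable_hypergeo_2F1 [measurable]:
  "hypergeo_2F1 a b c \<in> borel_measurable borel"
proof -
  have "(\<lambda>z. \<Sum>n. pochhammer a n * pochhammer b n / (pochhammer c n * fact n) * z ^ n)
      \<in> borel_measurable borel"
    by measurable
  then show ?thesis by (simp add: hypergeo_2F1_altdef[abs_def] cong: measurable_cong)
qed

lemma binomial_series_powr_minus:
  fixes x p :: real
  assumes "\<bar>x\<bar> < 1"
  shows "(\<lambda>n. pochhammer p n / fact n * x ^ n) sums (1 - x) powr (- p)"
proof -
  have "(\<lambda>n. ((-p) gchoose n) * (-x) ^ n) sums (1 + (-x)) powr (-p)"
    using assms by (intro gen_binomial_real) auto
  moreover have "((-p) gchoose n) * (-x) ^ n = pochhammer p n / fact n * x ^ n" for n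
    by (simp add: gbinomial_pochhammer power_minus[of x])
  ultimately show ?thesis by simp
qed

text \<open>A power series that converges at some y with |x| < y < 1 converges absolutely at
  x.\<close>

lemma summable_norm_binomial_series:
  fixes x p :: real
  assumes "\<bar>x\<bar> < 1"
  shows "summable (\<lambda>n. \<bar>pochhammer p n / fact n\<bar> * \<bar>x\<bar> ^ n)"
proof -
  obtain y where y: "\<bar>x\<bar> < y" "y < 1" using assms dense by blast
  have "summable (\<lambda>n. pochhammer p n / fact n * y ^ n)"
    using binomial_series_powr_minus[of y p] y by (auto simp: summable_def)
  then have "summable (\<lambda>n. norm (pochhammer p n / fact n * x ^ n))"
    by (rule powser_insidea) (use y in auto)
  then show ?thesis by (simp add: abs_mult power_abs)
qed

text \<open>These are the moments of the Beta integrand. The Pochhammer quotient turns the binomial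
  coefficients of (1 - z w)^(-p) into the coefficients of 2F1.\<close>

lemma Beta_add_nat_left:
  fixes a b :: real
  assumes "a > 0" "b > 0"
  shows "Beta (a + real n) b = Beta a b * pochhammer a n / pochhammer (a + b) n"
proof -
  have "a \<notin> \<int>\<^sub>\<le>\<^sub>0" "a + b \<notin> \<int>\<^sub>\<le>\<^sub>0" using assms by auto
  then have "pochhammer a n = Gamma (a + n) / Gamma a"
    "pochhammer (a + b) n = Gamma (a + b + n) / Gamma (a + b)"
    by (simp_all add: pochhammer_Gamma)
  moreover have "Gamma a > 0" "Gamma (a + b) > 0" "Gamma (a + b + n) > 0"
    using assms by (auto intro!: Gamma_real_pos)
  ultimately show ?thesis by (simp add: Beta_def field_simps)
qed

text \<open>The gauge integral for Beta carries over to the Lebesgue integral because the integrand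
  is nonnegative.\<close>

lemma integrable_Beta_kernel:
  fixes a b :: real
  assumes "a > 0" "b > 0"
  shows "integrable lborel (\<lambda>w. indicator {0..1} w * (w powr (a - 1) * (1 - w) powr (b - 1)))"
    and "(\<integral>w. indicator {0..1} w * (w powr (a - 1) * (1 - w) powr (b - 1)) \<partial>lborel) = Beta a b"
proof -
  have "(\<integral>\<^sup>+w. ennreal (indicator {0..1} w * (w powr (a - 1) * (1 - w) powr (b - 1))) \<partial>lborel)
      = ennreal (Beta a b)"
    by (rule nn_integral_has_integral_lebesgue) (use has_integral_Beta_real[OF assms] in auto)
  moreover have "Beta a b \<ge> 0"
    using assms by (auto simp: Beta_def intro!: divide_nonneg_nonneg mult_nonneg_nonneg less_imp_le[OF Gamma_real_pos])
  ultimately show "integrable lborel (\<lambda>w. indicator {0..1} w * (w powr (a - 1) * (1 - w) powr (b - 1)))"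
    and "(\<integral>w. indicator {0..1} w * (w powr (a - 1) * (1 - w) powr (b - 1)) \<partial>lborel) = Beta a b"
    by (subst (asm) nn_integral_eq_integrable; auto simp: indicator_def)+
qed

text \<open>Expand (1 - z w)^(-p) in its binomial series and integrate term by term. Since p may
  have either sign, the exchange rests on absolute summability: the moments
  \<open>Beta (a + n) b\<close> are at most \<open>Beta a b\<close>, and the coefficients
  \<open>c n\<close> are absolutely summable for 0 \<le> z < 1.\<close>

lemma Euler_integral_2F1:
  fixes a b z p :: real
  assumes "a > 0" "b > 0" "0 \<le> z" "z < 1"
  shows "integrable lborel (\<lambda>w. indicator {0..1} w *
           (w powr (a - 1) * (1 - w) powr (b - 1) * (1 - z * w) powr (- p)))" (is ?int)
    and "(\<integral>w. indicator {0..1} w *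
           (w powr (a - 1) * (1 - w) powr (b - 1) * (1 - z * w) powr (- p)) \<partial>lborel)
         = Beta a b * hypergeo_2F1 p a (a + b) z" (is ?eq)
proof -
  define c where "c n = pochhammer p n / fact n * z ^ n" for n
  define t where "t n w = indicator {0..1} w * (w powr (a + n - 1) * (1 - w) powr (b - 1)) * c n" for n and w :: real
  have int_t: "integrable lborel (t n)" for n
    unfolding t_def using integrable_Beta_kernel(1)[of "a + n" b] assms
    by (intro integrable_mult_left) auto
  have lint_t: "(\<integral>w. t n w \<partial>lborel) = Beta (a + n) b * c n" for n
    unfolding t_def using integrable_Beta_kernel(2)[of "a + n" b] assms
    by (subst integral_mult_left_zero) auto
  have lint_norm_t: "(\<integral>w. norm (t n w) \<partial>lborel) = Beta (a + n) b * \<bar>c n\<bar>" for n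
  proof -
    have "norm (t n w) = indicator {0..1} w * (w powr (a + n - 1) * (1 - w) powr (b - 1)) * \<bar>c n\<bar>" for w
      by (auto simp: t_def abs_mult indicator_def)
    then show ?thesis using integrable_Beta_kernel(2)[of "a + n" b] assms
      by (simp only:) (subst integral_mult_left_zero, auto)
  qed
  have Beta_nonneg: "Beta x b \<ge> 0" if "x > 0" for x
    using that assms by (auto simp: Beta_def intro!: divide_nonneg_nonneg mult_nonneg_nonneg less_imp_le[OF Gamma_real_pos])
  have Beta_le: "Beta (a + real n) b \<le> Beta a b" for n
  proof -
    have "pochhammer a n \<le> pochhammer (a + b) n"
      unfolding pochhammer_prod using assms by (intro prod_mono) auto
    moreover have "pochhammer (a + b) n > 0" using assms by (intro pochhammer_pos) auto
    ultimately have "pochhammer a n / pochhammer (a + b) n \<le> 1" by simp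
    then have "Beta a b * (pochhammer a n / pochhammer (a + b) n) \<le> Beta a b * 1"
      by (intro mult_left_mono Beta_nonneg) (use assms in auto)
    then show ?thesis using Beta_add_nat_left[of a b n] assms by simp
  qed
  have summ_c: "summable (\<lambda>n. \<bar>c n\<bar>)"
    using summable_norm_binomial_series[of z p] assms by (simp add: c_def abs_mult)
  have summ_norm: "summable (\<lambda>n. \<integral>w. norm (t n w) \<partial>lborel)"
  proof (rule summable_comparison_test')
    show "summable (\<lambda>n. Beta a b * \<bar>c n\<bar>)" using summ_c by (rule summable_mult)
    show "norm (\<integral>w. norm (t n w) \<partial>lborel) \<le> Beta a b * \<bar>c n\<bar>" for n
      unfolding lint_norm_t using Beta_le[of n] Beta_nonneg[of "a + n"] assms
      by (auto simp: abs_mult intro!: mult_right_mono)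
  qed
  have t_sums: "(\<lambda>n. t n w) sums (indicator {0..1} w *
           (w powr (a - 1) * (1 - w) powr (b - 1) * (1 - z * w) powr (- p)))"
    and t_summ: "summable (\<lambda>n. norm (t n w))"
    for w
  proof -
    have t_eq: "t n w = indicator {0<..1} w * (w powr (a - 1) * (1 - w) powr (b - 1)) *
        (pochhammer p n / fact n * (z * w) ^ n)" for n
      by (auto simp: t_def c_def indicator_def powr_diff powr_add powr_realpow power_mult_distrib)
    have zw: "\<bar>z * w\<bar> < 1" if "w \<in> {0<..1}"
    proof -
      have "z * w \<le> z * 1" using that assms by (intro mult_left_mono) auto
      then show ?thesis using that assms by auto
    qed
    show "(\<lambda>n. t n w) sums (indicator {0..1} w *
           (w powr (a - 1) * (1 - w) powr (b - 1) * (1 - z * w) powr (- p)))"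
    proof (cases "w \<in> {0<..1}")
      case True
      then show ?thesis unfolding t_eq
        using sums_mult[OF binomial_series_powr_minus[OF zw], of "w powr (a - 1) * (1 - w) powr (b - 1)"]
        by simp
    next
      case False
      then show ?thesis unfolding t_eq by (auto simp: indicator_def)
    qed
    show "summable (\<lambda>n. norm (t n w))"
    proof (cases "w \<in> {0<..1}")
      case True
      then show ?thesis unfolding t_eq
        using summable_mult[OF summable_norm_binomial_series[OF zw], of "\<bar>w powr (a - 1) * (1 - w) powr (b - 1)\<bar>" p]
        by (simp add: abs_mult power_abs power_mult_distrib)
    next
      case False
      then show ?thesis unfolding t_eq by (auto simp: indicator_def)
    qed
  qed
  have sum_t: "(\<lambda>w. \<Sum>n. t n w) = (\<lambda>w. indicator {0..1} w *
           (w powr (a - 1) * (1 - w) powr (b - 1) * (1 - z * w) powr (- p)))"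
    using t_sums by (simp add: sums_iff)
  show ?int
    using integrable_suminf[of lborel t] int_t t_summ summ_norm unfolding sum_t by auto
  have "(\<integral>w. (\<Sum>n. t n w) \<partial>lborel) = (\<Sum>n. \<integral>w. t n w \<partial>lborel)"
    by (rule integral_suminf) (use int_t t_summ summ_norm in auto)
  also have "\<dots> = (\<Sum>n. Beta a b * (pochhammer p n * pochhammer a n / (pochhammer (a + b) n * fact n) * z ^ n))"
    unfolding lint_t using assms by (intro suminf_cong) (simp add: Beta_add_nat_left c_def)
  also have "\<dots> = Beta a b * hypergeo_2F1 p a (a + b) z"
  proof -
    \<comment> \<open>Cancelling the positive Beta factor transfers summability to the
      hypergeometric series itself; only then may the factor be pulled out of
      \<open>suminf\<close>.\<close>
    have *: "Beta a b > 0" using assms by (simp add: Beta_def)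
    have "summable (\<lambda>n. Beta a b * (pochhammer p n * pochhammer a n / (pochhammer (a + b) n * fact n) * z ^ n))"
      using summable_integral[of lborel t] int_t t_summ summ_norm
      unfolding lint_t using assms by (simp add: Beta_add_nat_left c_def mult_ac)
    then have "summable (\<lambda>n. pochhammer p n * pochhammer a n / (pochhammer (a + b) n * fact n) * z ^ n)"
      using * by (simp only: summable_cmult_iff) auto
    then show ?thesis unfolding hypergeo_2F1_altdef by (rule suminf_mult)
  qed
  finally show ?eq unfolding sum_t .
qed

section \<open>Convolution kernels\<close>


text \<open>Values in \<open>ennreal\<close> make commutativity and associativity depend on
  measurability alone; finiteness is settled later through closed forms.\<close>

definition econv :: "(real \<Rightarrow> ennreal) \<Rightarrow> (real \<Rightarrow> ennreal) \<Rightarrow> real \<Rightarrow> ennreal" where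
  "econv k l s = (\<integral>\<^sup>+r. k r * l (s - r) \<partial>lborel)"

lemma borel_measurable_econv [measurable]:
  assumes [measurable]: "k \<in> borel_measurable borel" "l \<in> borel_measurable borel"
  shows "econv k l \<in> borel_measurable borel"
  unfolding econv_def[abs_def] by measurable

lemma econv_commute:
  assumes [measurable]: "k \<in> borel_measurable borel" "l \<in> borel_measurable borel"
  shows "econv k l = econv l k"
proof
  fix s
  have "econv k l s = (\<integral>\<^sup>+r. k (s + (-1) * r) * l (s - (s + (-1) * r)) \<partial>lborel)"
    unfolding econv_def by (subst nn_integral_real_affine[where c = "-1" and t = s]) auto
  then show "econv k l s = econv l k s" by (simp add: econv_def mult.commute)
qed

lemma nn_integral_lborel_shift:
  fixes f :: "real \<Rightarrow> ennreal"
  assumes "f \<in> borel_measurable borel"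
  shows "(\<integral>\<^sup>+r. f (r + t) \<partial>lborel) = (\<integral>\<^sup>+r. f r \<partial>lborel)"
  using nn_integral_real_affine[OF assms, of 1 t] by (simp add: add.commute)

text \<open>Tonelli for the nonnegative triple product, followed by translation invariance of the
  inner integral.\<close>

lemma econv_assoc:
  assumes [measurable]: "k \<in> borel_measurable borel" "l \<in> borel_measurable borel" "m \<in> borel_measurable borel"
  shows "econv (econv k l) m = econv k (econv l m)"
proof
  fix s
  have "econv (econv k l) m s = (\<integral>\<^sup>+r. (\<integral>\<^sup>+q. k q * l (r - q) * m (s - r) \<partial>lborel) \<partial>lborel)"
    unfolding econv_def by (intro nn_integral_cong) (simp add: nn_integral_multc)
  also have "\<dots> = (\<integral>\<^sup>+q. (\<integral>\<^sup>+r. k q * l (r - q) * m (s - r) \<partial>lborel) \<partial>lborel)"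
    by (rule lborel_pair.Fubini') measurable
  also have "\<dots> = (\<integral>\<^sup>+q. k q * (\<integral>\<^sup>+r. l (r - q) * m (s - r) \<partial>lborel) \<partial>lborel)"
    by (intro nn_integral_cong) (simp add: nn_integral_cmult[symmetric] mult.assoc)
  also have "\<dots> = (\<integral>\<^sup>+q. k q * (\<integral>\<^sup>+r. l r * m (s - q - r) \<partial>lborel) \<partial>lborel)"
  proof -
    have "(\<integral>\<^sup>+r. l (r - q) * m (s - r) \<partial>lborel) = (\<integral>\<^sup>+r. l r * m (s - q - r) \<partial>lborel)" for q
      using nn_integral_lborel_shift[of "\<lambda>r. l (r - q) * m (s - r)" q] by (simp add: algebra_simps)
    then show ?thesis by simp
  qed
  finally show "econv (econv k l) m s = econv k (econv l m) s" by (simp add: econv_def)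
qed

text \<open>Exponentials are characters: exp (c r) exp (c (s - r)) = exp (c s) does not depend on r
  and leaves the integral. Power weights in t become such exponentials in logarithmic
  coordinates.\<close>

lemma econv_exp_mult:
  assumes [measurable]: "k \<in> borel_measurable borel" "l \<in> borel_measurable borel"
  shows "econv (\<lambda>s. ennreal (exp (c * s)) * k s) (\<lambda>s. ennreal (exp (c * s)) * l s) s
         = ennreal (exp (c * s)) * econv k l s"
proof -
  have "(ennreal (exp (c * r)) * k r) * (ennreal (exp (c * (s - r))) * l (s - r)) =
        ennreal (exp (c * s)) * (k r * l (s - r))" for r
  proof -
    have "ennreal (exp (c * s)) = ennreal (exp (c * r)) * ennreal (exp (c * (s - r)))"
      by (simp add: ennreal_mult[symmetric] exp_add[symmetric] algebra_simps)
    then show ?thesis by (simp add: mult_ac)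
  qed
  then show ?thesis unfolding econv_def by (simp add: nn_integral_cmult)
qed

section \<open>Erdelyi-Kober kernels and their convolutions\<close>

text \<open>The operator \<open>K\<^sub>a\<^sup>\<alpha>\<close> sends \<open>g\<close> to the function with value
  \<open>\<integral> ek_kernel a \<alpha> s * g (t * e\<^sup>s) ds\<close> at \<open>t\<close>.\<close>

definition ek_kernel :: "real \<Rightarrow> real \<Rightarrow> real \<Rightarrow> real" where
  "ek_kernel a \<alpha> s = (if s > 0 then exp (- a * s) * (1 - exp (- s)) powr (\<alpha> - 1) / Gamma \<alpha> else 0)"

lemma borel_measurable_ek_kernel [measurable]: "ek_kernel a \<alpha> \<in> borel_measurable borel"
  unfolding ek_kernel_def[abs_def] by measurable

lemma ek_kernel_nonneg: "\<alpha> > 0 \<Longrightarrow> ek_kernel a \<alpha> s \<ge> 0"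
  by (simp add: ek_kernel_def less_imp_le[OF Gamma_real_pos])

text \<open>The closed form of \<open>econv (ek_kernel a \<alpha>) (ek_kernel b \<beta>)\<close>.
  The two pairs of parameters enter asymmetrically although convolution commutes, so the order of
  the factors can be chosen to simplify the 2F1.\<close>

definition ek_conv :: "real \<Rightarrow> real \<Rightarrow> real \<Rightarrow> real \<Rightarrow> real \<Rightarrow> real" where
  "ek_conv a \<alpha> b \<beta> s = (if s > 0 then exp (- b * s) * (1 - exp (- s)) powr (\<alpha> + \<beta> - 1) / Gamma (\<alpha> + \<beta>)
     * hypergeo_2F1 (\<beta> + b - a) \<alpha> (\<alpha> + \<beta>) (1 - exp (- s)) else 0)"

lemma borel_measurable_ek_conv [measurable]: "ek_conv a \<alpha> b \<beta> \<in> borel_measurable borel"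
  unfolding ek_conv_def[abs_def] by measurable

text \<open>With z = 1 - exp (- s), the substitution w = (1 - exp (- q)) / z maps [0, s] onto [0, 1]
  and turns the convolution into Euler's integral. Here 1 - z w = exp (- q), and 1 - w is exp (- q)
  (1 - exp (- (s - q))) / z.\<close>

lemma econv_ek_kernel:
  assumes "\<alpha> > 0" "\<beta> > 0"
  shows "econv (ek_kernel a \<alpha>) (ek_kernel b \<beta>) s = ennreal (ek_conv a \<alpha> b \<beta> s)"
    and "ek_conv a \<alpha> b \<beta> s \<ge> 0"
proof -
  have "econv (ek_kernel a \<alpha>) (ek_kernel b \<beta>) s = ennreal (ek_conv a \<alpha> b \<beta> s) \<and> ek_conv a \<alpha> b \<beta> s \<ge> 0"
  proof (cases "s > 0")
    case False
    then have "ennreal (ek_kernel a \<alpha> r) * ennreal (ek_kernel b \<beta> (s - r)) = 0" for r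
      by (auto simp: ek_kernel_def)
    then have "econv (ek_kernel a \<alpha>) (ek_kernel b \<beta>) s = 0"
      by (simp only: econv_def nn_integral_const mult_zero_left)
    with False show ?thesis by (simp add: ek_conv_def)
  next
    case True
    define z where "z = 1 - exp (- s)"
    have z: "0 < z" "z < 1" using True by (auto simp: z_def)
    \<comment> \<open>This exponent collects all powers of exp (- q): after 1 - w and the Jacobian
      contribute \<beta>, a net power a - b must remain to match exp (- a q) exp (- b (s -
      q)).\<close>
    define p where "p = \<beta> + b - a"
    define C where "C = exp (- b * s) * z powr (\<alpha> + \<beta> - 1) / (Gamma \<alpha> * Gamma \<beta>)"
    have C: "C \<ge> 0" using assms by (auto simp: C_def less_imp_le[OF Gamma_real_pos])
    define f where "f w = C * (w powr (\<alpha> - 1) * (1 - w) powr (\<beta> - 1) * (1 - z * w) powr (- p))" for w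
    have f_nonneg: "f w \<ge> 0" for w using C by (simp add: f_def)
    have [measurable]: "f \<in> borel_measurable borel" unfolding f_def[abs_def] by measurable
    define g where "g q = (1 - exp (- q)) / z" for q
    have point: "ek_kernel a \<alpha> q * ek_kernel b \<beta> (s - q) = f (g q) * (exp (- q) / z)"
      if q: "q \<in> {0..s}" for q
    proof -
      \<comment> \<open>At both endpoints one of the kernels is 0 by definition, and the right side
        is 0 because \<open>0 powr e\<close> is 0, even for negative e.\<close>
      consider "q = 0" | "q = s" | "0 < q" "q < s" using q by fastforce
      then show ?thesis
      proof cases
        case 1
        then show ?thesis by (simp add: ek_kernel_def f_def g_def)
      next
        case 2
        then show ?thesis using z by (simp add: ek_kernel_def f_def g_def z_def)
      next
        case 3
        define u v where "u = 1 - exp (- q)" and "v = 1 - exp (- (s - q))"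
        have uv: "u > 0" "v > 0" using 3 by (auto simp: u_def v_def)
        have e: "1 - z * g q = exp (- q)" using z by (simp add: g_def)
        have "1 - g q = (z - u) / z" using z by (simp add: g_def u_def field_simps)
        also have "z - u = exp (- q) * v"
          by (simp add: z_def u_def v_def algebra_simps exp_add[symmetric])
        finally have e2: "1 - g q = exp (- q) * v / z" .
        have e3: "g q = u / z" by (simp add: g_def u_def)
        have zp: "z powr (\<alpha> + \<beta> - 1) = z powr (\<alpha> - 1) * z powr (\<beta> - 1) * z"
          using z by (simp add: powr_add powr_diff)
        have ex: "exp (- b * s) * exp (- q) powr (\<beta> - 1) * exp (- q) powr (- p) * exp (- q)
           = exp (- a * q) * exp (- b * (s - q))"
          by (simp add: powr_def exp_add[symmetric] p_def algebra_simps)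
        have "f (g q) * (exp (- q) / z) =
            (exp (- b * s) * exp (- q) powr (\<beta> - 1) * exp (- q) powr (- p) * exp (- q))
             * u powr (\<alpha> - 1) * v powr (\<beta> - 1) / (Gamma \<alpha> * Gamma \<beta>)"
          unfolding f_def e e2 unfolding C_def zp e3 using z uv
          by (simp add: powr_mult powr_divide field_simps)
        also have "\<dots> = ek_kernel a \<alpha> q * ek_kernel b \<beta> (s - q)"
          unfolding ex using 3 by (simp add: ek_kernel_def u_def v_def)
        finally show ?thesis ..
      qed
    qed
    have Gamma_nz: "Gamma \<alpha> \<noteq> 0" "Gamma \<beta> \<noteq> 0"
      using assms Gamma_real_pos by (metis less_irrefl)+
    have "econv (ek_kernel a \<alpha>) (ek_kernel b \<beta>) s =
        (\<integral>\<^sup>+q. ennreal (f (g q)) * ennreal (exp (- q) / z) * indicator {0..s} q \<partial>lborel)"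
      unfolding econv_def
    proof (intro nn_integral_cong)
      fix q
      show "ennreal (ek_kernel a \<alpha> q) * ennreal (ek_kernel b \<beta> (s - q)) =
         ennreal (f (g q)) * ennreal (exp (- q) / z) * indicator {0..s} q"
      proof (cases "q \<in> {0..s}")
        case True
        then show ?thesis using point[OF True] f_nonneg z
          by (simp add: ennreal_mult[symmetric] ek_kernel_nonneg assms)
      next
        case False
        then show ?thesis by (auto simp: ek_kernel_def)
      qed
    qed
    also have "\<dots> = (\<integral>\<^sup>+w. ennreal (f w) * indicator {g 0..g s} w \<partial>lborel)"
    proof (rule nn_integral_substitution_aux[symmetric])
      show "(g has_real_derivative exp (- x) / z) (at x)" for x
        unfolding g_def using z by (auto intro!: derivative_eq_intros)
    qed (use z True in \<open>auto intro!: continuous_intros\<close>)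
    also have "\<dots> = (\<integral>\<^sup>+w. ennreal (C * (indicator {0..1} w * (w powr (\<alpha> - 1) * (1 - w) powr (\<beta> - 1) * (1 - z * w) powr (- p)))) \<partial>lborel)"
      using z by (intro nn_integral_cong) (auto simp: g_def z_def f_def indicator_def)
    also have "\<dots> = ennreal (C * (Beta \<alpha> \<beta> * hypergeo_2F1 p \<alpha> (\<alpha> + \<beta>) z))"
      using Euler_integral_2F1[of \<alpha> \<beta> z p] assms z C
      by (subst nn_integral_eq_integral) auto
    also have "C * (Beta \<alpha> \<beta> * hypergeo_2F1 p \<alpha> (\<alpha> + \<beta>) z) = ek_conv a \<alpha> b \<beta> s"
      using Gamma_nz True
      by (simp add: C_def Beta_def p_def ek_conv_def z_def)
    finally have eq: "econv (ek_kernel a \<alpha>) (ek_kernel b \<beta>) s = ennreal (ek_conv a \<alpha> b \<beta> s)" .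
    \<comment> \<open>The series has no fixed sign termwise, as p may be negative. The sign of 2F1
      is read off from the nonnegative integrand.\<close>
    have "0 \<le> (\<integral>w. indicator {0..1} w * (w powr (\<alpha> - 1) * (1 - w) powr (\<beta> - 1) * (1 - z * w) powr (- p)) \<partial>lborel)"
      by (intro integral_nonneg_AE) auto
    then have "0 \<le> Beta \<alpha> \<beta> * hypergeo_2F1 p \<alpha> (\<alpha> + \<beta>) z"
      using Euler_integral_2F1(2)[of \<alpha> \<beta> z p] assms z by simp
    moreover have "Beta \<alpha> \<beta> > 0" using assms by (simp add: Beta_def)
    ultimately have "hypergeo_2F1 p \<alpha> (\<alpha> + \<beta>) z \<ge> 0"
      by (simp add: zero_le_mult_iff)
    then have "ek_conv a \<alpha> b \<beta> s \<ge> 0"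
      using True Gamma_real_pos[of "\<alpha> + \<beta>"] assms by (simp add: ek_conv_def z_def p_def)
    with eq show ?thesis by simp
  qed
  then show "econv (ek_kernel a \<alpha>) (ek_kernel b \<beta>) s = ennreal (ek_conv a \<alpha> b \<beta> s)"
    and "ek_conv a \<alpha> b \<beta> s \<ge> 0" by auto
qed

text \<open>Exchanging the factors first makes the leading parameter of the 2F1 equal to \<alpha> +
  a - (a + \<alpha>) = 0, so the 2F1 is 1. In the original order it would be 2F1(\<alpha> + \<beta>,
  \<alpha>; \<alpha> + \<beta>; z), a nontrivial power of 1 - z.\<close>

lemma econv_ek_kernel_add:
  assumes "\<alpha> > 0" "\<beta> > 0"
  shows "econv (ek_kernel a \<alpha>) (ek_kernel (a + \<alpha>) \<beta>) = (\<lambda>s. ennreal (ek_kernel a (\<alpha> + \<beta>) s))"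
proof
  fix s
  have "econv (ek_kernel a \<alpha>) (ek_kernel (a + \<alpha>) \<beta>) s = econv (ek_kernel (a + \<alpha>) \<beta>) (ek_kernel a \<alpha>) s"
    by (subst econv_commute) auto
  also have "\<dots> = ennreal (ek_conv (a + \<alpha>) \<beta> a \<alpha> s)"
    using assms by (intro econv_ek_kernel)
  also have "ek_conv (a + \<alpha>) \<beta> a \<alpha> s = ek_kernel a (\<alpha> + \<beta>) s"
    by (simp add: ek_conv_def ek_kernel_def hypergeo_2F1_0_left add.commute)
  finally show "econv (ek_kernel a \<alpha>) (ek_kernel (a + \<alpha>) \<beta>) s = ennreal (ek_kernel a (\<alpha> + \<beta>) s)" .
qed


lemma econv_cmult_left:
  assumes [measurable]: "k \<in> borel_measurable borel" "l \<in> borel_measurable borel"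
  shows "econv (\<lambda>s. c * k s) l s = c * econv k l s"
  by (simp add: econv_def nn_integral_cmult mult.assoc)

section \<open>The kernel of the fractional Bessel integral\<close>

lemma econv_cmult_right:
  assumes [measurable]: "k \<in> borel_measurable borel" "l \<in> borel_measurable borel"
  shows "econv k (\<lambda>s. c * l s) s = c * econv k l s"
  using econv_cmult_left[of l k c s] by (simp add: econv_commute[of k])

text \<open>The index - (\<nu> - 1) / 2 is -\<eta>, so the \<open>ek_conv\<close> factor represents
  the composition of the operators with indices -\<eta> and 0. The weight t^\<alpha>, taken at x^2
  exp s, splits into exp (\<alpha> s) and a prefactor x^(2 \<alpha>) that is kept outside the
  kernel.\<close>

definition bessel_kernel :: "real \<Rightarrow> real \<Rightarrow> real \<Rightarrow> real" where
  "bessel_kernel \<nu> \<alpha> s = (1/4) powr \<alpha> * (exp (\<alpha> * s) * ek_conv (- ((\<nu> - 1) / 2)) \<alpha> 0 \<alpha> s)"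

lemma borel_measurable_bessel_kernel [measurable]: "bessel_kernel \<nu> \<alpha> \<in> borel_measurable borel"
  unfolding bessel_kernel_def[abs_def] by measurable

lemma bessel_kernel_nonneg: "\<alpha> > 0 \<Longrightarrow> bessel_kernel \<nu> \<alpha> s \<ge> 0"
  by (simp add: bessel_kernel_def econv_ek_kernel(2))

lemma bessel_kernel_eq_0: "s \<le> 0 \<Longrightarrow> bessel_kernel \<nu> \<alpha> s = 0"
  by (simp add: bessel_kernel_def ek_conv_def)

lemma ennreal_bessel_kernel:
  assumes "\<alpha> > 0"
  shows "ennreal (bessel_kernel \<nu> \<alpha> s) = ennreal ((1/4) powr \<alpha>) *
    (ennreal (exp (\<alpha> * s)) * econv (ek_kernel (- ((\<nu> - 1) / 2)) \<alpha>) (ek_kernel 0 \<alpha>) s)"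
  using assms by (simp add: bessel_kernel_def econv_ek_kernel ennreal_mult)

text \<open>Moving the weight \<open>t\<^sup>\<alpha>\<close> across \<open>K\<^sub>a\<^sup>\<beta>\<close> raises its index to \<open>a + \<alpha>\<close>.\<close>

lemma ek_kernel_shift:
  "exp (\<beta> * s) * ek_kernel a \<beta> s = exp ((\<alpha> + \<beta>) * s) * ek_kernel (a + \<alpha>) \<beta> s"
  by (simp add: ek_kernel_def exp_add[symmetric] algebra_simps)

text \<open>The semigroup law at the level of kernels. The factor exp (\<beta> s) accounts for the
  prefactor of the inner integral, evaluated at x exp (s / 2). Once every weight is brought to exp
  ((\<alpha> + \<beta>) s), the indices of the second kernel are raised by \<alpha>, as
  \<open>econv_ek_kernel_add\<close> requires.\<close>

lemma econv_bessel_kernel: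
  assumes "\<alpha> > 0" "\<beta> > 0"
  shows "econv (\<lambda>s. ennreal (exp (\<beta> * s) * bessel_kernel \<nu> \<alpha> s)) (bessel_kernel \<nu> \<beta>) s
         = ennreal (bessel_kernel \<nu> (\<alpha> + \<beta>) s)"
proof -
  define a where "a = - ((\<nu> - 1) / 2)"
  let ?E = "\<lambda>c s. ennreal (exp (c * s))"
  let ?K = "\<lambda>a \<alpha> s. ennreal (ek_kernel a \<alpha> s)"
  have E: "?E (\<alpha> + \<beta>) s = ?E \<alpha> s * ?E \<beta> s" for s
    by (simp add: ennreal_mult[symmetric] exp_add[symmetric] distrib_right)
  have left: "(\<lambda>s. ennreal (exp (\<beta> * s) * bessel_kernel \<nu> \<alpha> s)) =
      (\<lambda>s. ennreal ((1/4) powr \<alpha>) * (?E (\<alpha> + \<beta>) s * econv (?K a \<alpha>) (?K 0 \<alpha>) s))"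
  proof
    fix s
    have "ennreal (exp (\<beta> * s) * bessel_kernel \<nu> \<alpha> s) = ?E \<beta> s * ennreal (bessel_kernel \<nu> \<alpha> s)"
      using assms by (simp add: ennreal_mult bessel_kernel_nonneg)
    then show "ennreal (exp (\<beta> * s) * bessel_kernel \<nu> \<alpha> s) =
      ennreal ((1/4) powr \<alpha>) * (?E (\<alpha> + \<beta>) s * econv (?K a \<alpha>) (?K 0 \<alpha>) s)"
      unfolding ennreal_bessel_kernel[OF assms(1)] E a_def by (simp only: ac_simps)
  qed
  have shift: "(\<lambda>s. ?E \<beta> s * ?K c \<beta> s) = (\<lambda>s. ?E (\<alpha> + \<beta>) s * ?K (c + \<alpha>) \<beta> s)" for c
    using assms ek_kernel_shift[of \<beta> _ c \<alpha>]
    by (intro ext) (simp add: ennreal_mult[symmetric] ek_kernel_nonneg)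
  have right: "(\<lambda>s. ennreal (bessel_kernel \<nu> \<beta> s)) =
      (\<lambda>s. ennreal ((1/4) powr \<beta>) * (?E (\<alpha> + \<beta>) s * econv (?K (a + \<alpha>) \<beta>) (?K (0 + \<alpha>) \<beta>) s))"
  proof
    fix s
    have "?E \<beta> s * econv (?K a \<beta>) (?K 0 \<beta>) s =
        econv (\<lambda>s. ?E \<beta> s * ?K a \<beta> s) (\<lambda>s. ?E \<beta> s * ?K 0 \<beta> s) s"
      by (rule econv_exp_mult[symmetric]; measurable)
    also have "\<dots> = ?E (\<alpha> + \<beta>) s * econv (?K (a + \<alpha>) \<beta>) (?K (0 + \<alpha>) \<beta>) s"
      unfolding shift by (rule econv_exp_mult; measurable)
    finally have "?E \<beta> s * econv (?K a \<beta>) (?K 0 \<beta>) s =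
        ?E (\<alpha> + \<beta>) s * econv (?K (a + \<alpha>) \<beta>) (?K (0 + \<alpha>) \<beta>) s" .
    then show "ennreal (bessel_kernel \<nu> \<beta> s) =
      ennreal ((1/4) powr \<beta>) * (?E (\<alpha> + \<beta>) s * econv (?K (a + \<alpha>) \<beta>) (?K (0 + \<alpha>) \<beta>) s)"
      using assms by (simp add: ennreal_bessel_kernel a_def)
  qed
  \<comment> \<open>Exchanging the two middle factors puts a next to a + \<alpha> and 0 next to 0 +
    \<alpha>.\<close>
  have swap: "econv (econv (?K a \<alpha>) (?K 0 \<alpha>)) (econv (?K (a + \<alpha>) \<beta>) (?K (0 + \<alpha>) \<beta>))
      = econv (?K a (\<alpha> + \<beta>)) (?K 0 (\<alpha> + \<beta>))"
  proof -
    have "econv (econv (?K a \<alpha>) (?K 0 \<alpha>)) (econv (?K (a + \<alpha>) \<beta>) (?K (0 + \<alpha>) \<beta>))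
        = econv (?K a \<alpha>) (econv (econv (?K 0 \<alpha>) (?K (a + \<alpha>) \<beta>)) (?K (0 + \<alpha>) \<beta>))"
      by (simp add: econv_assoc)
    also have "\<dots> = econv (?K a \<alpha>) (econv (econv (?K (a + \<alpha>) \<beta>) (?K 0 \<alpha>)) (?K (0 + \<alpha>) \<beta>))"
      by (subst econv_commute[of "?K 0 \<alpha>"]) auto
    also have "\<dots> = econv (econv (?K a \<alpha>) (?K (a + \<alpha>) \<beta>)) (econv (?K 0 \<alpha>) (?K (0 + \<alpha>) \<beta>))"
      by (simp add: econv_assoc)
    also have "\<dots> = econv (?K a (\<alpha> + \<beta>)) (?K 0 (\<alpha> + \<beta>))"
      by (subst (1 2) econv_ek_kernel_add) (use assms in auto)
    finally show ?thesis .
  qed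
  have "econv (\<lambda>s. ennreal (exp (\<beta> * s) * bessel_kernel \<nu> \<alpha> s)) (bessel_kernel \<nu> \<beta>) s =
     ennreal ((1/4) powr \<alpha>) * (ennreal ((1/4) powr \<beta>) * (?E (\<alpha> + \<beta>) s *
        econv (econv (?K a \<alpha>) (?K 0 \<alpha>)) (econv (?K (a + \<alpha>) \<beta>) (?K (0 + \<alpha>) \<beta>)) s))"
    unfolding left right
    by (subst econv_cmult_left, measurable, subst econv_cmult_right, measurable, subst econv_exp_mult, measurable)
  also have "\<dots> = ennreal (bessel_kernel \<nu> (\<alpha> + \<beta>) s)"
    using assms unfolding swap
    by (simp add: ennreal_bessel_kernel a_def powr_add ennreal_mult mult_ac)
  finally show ?thesis .
qed

text \<open>\<open>ek_kernel b 1\<close> is an exponential, hence bounded below on bounded intervals.\<close>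

lemma nn_integral_atMost_finite_if_econv:
  fixes k :: "real \<Rightarrow> ennreal"
  assumes [measurable]: "k \<in> borel_measurable borel"
    and k0: "\<And>s. s \<le> 0 \<Longrightarrow> k s = 0"
    and fin: "econv k (ek_kernel b 1) (S + 1) < \<infinity>"
  shows "(\<integral>\<^sup>+s. k s * indicator {..S} s \<partial>lborel) < \<infinity>"
proof -
  \<comment> \<open>A lower bound for \<open>ek_kernel b 1\<close> at S + 1 - s when 0 < s \<le> S.
    The extra 1 keeps this argument positive up to s = S, since the kernel vanishes at 0.\<close>
  define \<delta> where "\<delta> = exp (- \<bar>b\<bar> * (S + 1))"
  have "ennreal \<delta> * (\<integral>\<^sup>+s. k s * indicator {..S} s \<partial>lborel)
      = (\<integral>\<^sup>+s. ennreal \<delta> * (k s * indicator {..S} s) \<partial>lborel)"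
    by (simp add: nn_integral_cmult)
  also have "\<dots> \<le> econv k (ek_kernel b 1) (S + 1)"
    unfolding econv_def
  proof (intro nn_integral_mono)
    fix s
    show "ennreal \<delta> * (k s * indicator {..S} s) \<le> k s * ennreal (ek_kernel b 1 (S + 1 - s))"
    proof (cases "0 < s \<and> s \<le> S")
      case True
      have "b * (S + 1 - s) \<le> \<bar>b\<bar> * (S + 1)"
        using True by (intro mult_mono) auto
      then have "\<delta> \<le> ek_kernel b 1 (S + 1 - s)"
        using True by (simp add: \<delta>_def ek_kernel_def)
      then show ?thesis using True by (simp add: mult.commute[of "ennreal \<delta>"] mult_left_mono ennreal_leI)
    next
      case False
      then show ?thesis using k0[of s] by (auto simp: indicator_def)
    qed
  qed
  also have "\<dots> < \<infinity>" by (rule fin)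
  finally show ?thesis by (auto simp: ennreal_mult_less_top \<delta>_def)
qed

text \<open>No estimate of the singularity at s = 0 is made. Convolving once more with
  \<open>ek_kernel \<alpha> 1\<close> gives the closed form with parameters (a, \<alpha>) and (0,
  \<alpha> + 1), a finite real, and this finiteness bounds the mass of the kernel on bounded
  intervals.\<close>

lemma integrable_bessel_kernel_atMost:
  assumes "\<alpha> > 0"
  shows "integrable lborel (\<lambda>s. bessel_kernel \<nu> \<alpha> s * indicator {..S} s)"
proof -
  let ?K = "\<lambda>a \<alpha> s. ennreal (ek_kernel a \<alpha> s)"
  define a where "a = - ((\<nu> - 1) / 2)"
  define k where "k = econv (?K a \<alpha>) (?K 0 \<alpha>)"
  have [measurable]: "k \<in> borel_measurable borel" unfolding k_def by measurable
  have "econv k (?K \<alpha> 1) = econv (?K a \<alpha>) (econv (?K 0 \<alpha>) (?K (0 + \<alpha>) 1))"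
    by (simp add: k_def econv_assoc)
  also have "\<dots> = econv (?K a \<alpha>) (?K 0 (\<alpha> + 1))"
    by (subst econv_ek_kernel_add) (use assms in auto)
  finally have fin: "econv k (?K \<alpha> 1) (S + 1) < \<infinity>"
    using assms by (simp add: econv_ek_kernel)
  have kfin: "(\<integral>\<^sup>+s. k s * indicator {..S} s \<partial>lborel) < \<infinity>"
    by (rule nn_integral_atMost_finite_if_econv[OF _ _ fin])
       (use assms in \<open>auto simp: k_def econv_ek_kernel ek_conv_def\<close>)
  define C where "C = (1/4) powr \<alpha> * exp (\<alpha> * S)"
  have "(\<integral>\<^sup>+s. ennreal (bessel_kernel \<nu> \<alpha> s * indicator {..S} s) \<partial>lborel)
      \<le> (\<integral>\<^sup>+s. ennreal C * (k s * indicator {..S} s) \<partial>lborel)"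
  proof (intro nn_integral_mono)
    fix s
    show "ennreal (bessel_kernel \<nu> \<alpha> s * indicator {..S} s) \<le> ennreal C * (k s * indicator {..S} s)"
    proof (cases "s \<le> S")
      case True
      have "ennreal (bessel_kernel \<nu> \<alpha> s) = ennreal ((1/4) powr \<alpha> * exp (\<alpha> * s)) * k s"
        using assms by (simp add: ennreal_bessel_kernel k_def a_def ennreal_mult mult_ac)
      also have "\<dots> \<le> ennreal C * k s"
        unfolding C_def using assms True by (intro mult_right_mono ennreal_leI mult_left_mono) auto
      finally show ?thesis using True by simp
    qed auto
  qed
  also have "\<dots> < \<infinity>"
    using kfin by (simp add: nn_integral_cmult ennreal_mult_less_top)
  finally show ?thesis
    by (intro integrableI_nonneg) (auto simp: bessel_kernel_nonneg assms)
qed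

section \<open>The fractional integral in logarithmic coordinates\<close>


text \<open>Carries a convolution identity over to iterated integrals against a signed h. Tonelli
  applied to |h| reduces joint integrability to that of m h, after which Fubini and a translation
  give the claim.\<close>

lemma econv_integral:
  fixes k l m h :: "real \<Rightarrow> real"
  assumes [measurable]: "k \<in> borel_measurable borel" "l \<in> borel_measurable borel" "h \<in> borel_measurable borel"
    and nonneg: "\<And>s. k s \<ge> 0" "\<And>s. l s \<ge> 0" "\<And>s. m s \<ge> 0"
    and conv: "\<And>s. econv k l s = ennreal (m s)"
    and int: "integrable lborel (\<lambda>s. m s * h s)"
  shows "(\<integral>r. k r * (\<integral>s. l s * h (r + s) \<partial>lborel) \<partial>lborel) = (\<integral>s. m s * h s \<partial>lborel)"
proof -
  define \<phi> where "\<phi> r s = k r * l (s - r) * h s" for r s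
  have [measurable]: "case_prod \<phi> \<in> borel_measurable (lborel \<Otimes>\<^sub>M lborel)"
    unfolding \<phi>_def case_prod_beta' by measurable
  have kl: "(\<integral>r. k r * l (s - r) \<partial>lborel) = m s" for s
  proof -
    have "(\<integral>\<^sup>+r. ennreal (k r * l (s - r)) \<partial>lborel) = ennreal (m s)"
      using conv[of s] by (simp add: econv_def ennreal_mult nonneg)
    then show ?thesis
      by (subst (asm) nn_integral_eq_integrable) (auto simp: nonneg)
  qed
  have "(\<integral>\<^sup>+p. ennreal (norm (case_prod \<phi> p)) \<partial>(lborel \<Otimes>\<^sub>M lborel))
      = (\<integral>\<^sup>+s. \<integral>\<^sup>+r. ennreal (norm (\<phi> r s)) \<partial>lborel \<partial>lborel)"
    by (subst lborel_pair.nn_integral_snd[symmetric]) auto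
  also have "\<dots> = (\<integral>\<^sup>+s. ennreal (norm (m s * h s)) \<partial>lborel)"
  proof (intro nn_integral_cong)
    fix s
    have "(\<integral>\<^sup>+r. ennreal (norm (\<phi> r s)) \<partial>lborel) = (\<integral>\<^sup>+r. (ennreal (k r) * ennreal (l (s - r))) * ennreal \<bar>h s\<bar> \<partial>lborel)"
      by (intro nn_integral_cong) (simp add: \<phi>_def abs_mult nonneg ennreal_mult)
    also have "\<dots> = econv k l s * ennreal \<bar>h s\<bar>"
      by (simp add: nn_integral_multc econv_def)
    finally show "(\<integral>\<^sup>+r. ennreal (norm (\<phi> r s)) \<partial>lborel) = ennreal (norm (m s * h s))"
      by (simp add: conv nonneg abs_mult ennreal_mult)
  qed
  also have "\<dots> < \<infinity>" using int by (simp add: integrable_iff_bounded)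
  finally have \<phi>_int: "integrable (lborel \<Otimes>\<^sub>M lborel) (case_prod \<phi>)"
    by (intro integrableI_bounded) auto
  have "(\<integral>s. m s * h s \<partial>lborel) = (\<integral>s. \<integral>r. \<phi> r s \<partial>lborel \<partial>lborel)"
    by (simp add: \<phi>_def kl)
  also have "\<dots> = (\<integral>r. \<integral>s. \<phi> r s \<partial>lborel \<partial>lborel)"
    by (rule lborel_pair.Fubini_integral[OF \<phi>_int])
  also have "\<dots> = (\<integral>r. k r * (\<integral>s. l s * h (r + s) \<partial>lborel) \<partial>lborel)"
  proof (rule Bochner_Integration.integral_cong[OF refl])
    fix r
    have "(\<integral>s. \<phi> r s \<partial>lborel) = (\<integral>s. \<phi> r (r + 1 * s) \<partial>lborel)"
      by (subst lborel_integral_real_affine[where c = 1 and t = r]) auto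
    then show "(\<integral>s. \<phi> r s \<partial>lborel) = k r * (\<integral>s. l s * h (r + s) \<partial>lborel)"
      by (simp add: \<phi>_def mult.assoc)
  qed
  finally show ?thesis ..
qed

text \<open>The substitution y = x exp (s / 2), that is y^2 = x^2 exp s. Integrability is not
  assumed: the change of variables theorem makes it equivalent on the two sides.\<close>

lemma lborel_integral_exp_substitution:
  fixes \<Phi> :: "real \<Rightarrow> real"
  assumes x: "x > 0" and meas: "set_borel_measurable borel {x<..} \<Phi>"
  shows "(LBINT y:{x<..}. \<Phi> y) = (LBINT s:{0<..}. x * exp (s / 2) / 2 * \<Phi> (x * exp (s / 2)))"
proof -
  define \<Psi> where "\<Psi> s = \<bar>x * exp (s / 2) / 2\<bar> * \<Phi> (x * exp (s / 2))" for s
  have image: "(\<lambda>s. x * exp (s / 2)) ` {0<..} = {x<..}"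
  proof safe
    fix y assume y: "x < y"
    then have "y / x > 1" using x by simp
    then have "ln (y / x) > 0" "exp (ln (y / x)) = y / x" by (simp_all add: exp_ln)
    then show "y \<in> (\<lambda>s. x * exp (s / 2)) ` {0<..}"
      using x by (intro image_eqI[of _ _ "2 * ln (y / x)"]) (simp_all del: ln_gt_zero_iff)
  qed (use x in auto)
  have *: "\<Psi> absolutely_integrable_on {0<..} \<and> integral {0<..} \<Psi> = b
      \<longleftrightarrow> \<Phi> absolutely_integrable_on {x<..} \<and> integral {x<..} \<Phi> = b" for b
    unfolding \<Psi>_def image[symmetric]
  proof (rule has_absolute_integral_change_of_variables_1')
    show "((\<lambda>s. x * exp (s / 2)) has_field_derivative x * exp (s / 2) / 2) (at s within {0<..})" for s
      by (auto intro!: derivative_eq_intros)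
    show "inj_on (\<lambda>s. x * exp (s / 2)) {0<..}" using x by (auto intro!: inj_onI)
  qed auto
  have meas\<Phi>: "(\<lambda>y. indicator {x<..} y *\<^sub>R \<Phi> y) \<in> borel_measurable lborel"
    using meas by (simp add: set_borel_measurable_def)
  have meas\<Psi>: "(\<lambda>s. indicator {0<..} s *\<^sub>R \<Psi> s) \<in> borel_measurable lborel"
  proof -
    have "(\<lambda>s. \<bar>x * exp (s / 2) / 2\<bar> * (indicator {x<..} (x * exp (s / 2)) *\<^sub>R \<Phi> (x * exp (s / 2)))) \<in> borel_measurable borel"
      using meas unfolding set_borel_measurable_def by measurable
    also have "(\<lambda>s. \<bar>x * exp (s / 2) / 2\<bar> * (indicator {x<..} (x * exp (s / 2)) *\<^sub>R \<Phi> (x * exp (s / 2))))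
       = (\<lambda>s. indicator {0<..} s *\<^sub>R \<Psi> s)"
      using x by (auto simp: \<Psi>_def indicator_def fun_eq_iff)
    finally show ?thesis by simp
  qed
  \<comment> \<open>A non-integrable function has Lebesgue integral 0, so both sides agree in that
    case too. Borel measurability allows the passage between \<open>lborel\<close> and
    \<open>lebesgue\<close>.\<close>
  have lint: "set_lebesgue_integral lborel S f =
      (if f absolutely_integrable_on S then integral S f else 0)"
    if "(\<lambda>y. indicator S y *\<^sub>R f y) \<in> borel_measurable lborel" for f :: "real \<Rightarrow> real" and S
  proof -
    have "set_lebesgue_integral lborel S f = set_lebesgue_integral lebesgue S f"
      unfolding set_lebesgue_integral_def by (rule integral_completion[symmetric, OF that])
    then show ?thesis
      using set_lebesgue_integral_eq_integral(2)[of S f]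
      by (auto simp: set_lebesgue_integral_def set_integrable_def not_integrable_integral_eq)
  qed
  have "(LBINT y:{x<..}. \<Phi> y) = (LBINT s:{0<..}. \<Psi> s)"
    unfolding lint[OF meas\<Phi>] lint[OF meas\<Psi>] using * by auto
  also have "\<dots> = (LBINT s:{0<..}. x * exp (s / 2) / 2 * \<Phi> (x * exp (s / 2)))"
    using x by (simp add: \<Psi>_def)
  finally show ?thesis .
qed

text \<open>For y = x exp (s / 2) the hypergeometric argument 1 - x^2 / y^2 becomes 1 - exp (- s),
  which is the argument in \<open>ek_conv\<close>. The operator thereby becomes a convolution in s
  with an explicit power of x in front.\<close>

lemma bessel_frac_integral_eq:
  fixes f :: "real \<Rightarrow> real"
  assumes \<alpha>: "\<alpha> > 0" and x: "x > 0" and f: "set_borel_measurable borel {0<..} f"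
  shows "bessel_frac_integral \<nu> \<alpha> f x =
    x powr (2 * \<alpha>) * (\<integral>s. bessel_kernel \<nu> \<alpha> s * f (x * exp (s / 2)) \<partial>lborel)"
proof -
  have G: "Gamma (2 * \<alpha>) \<noteq> 0" using \<alpha> by (intro less_imp_neq[symmetric] Gamma_real_pos) simp
  define \<Phi> where "\<Phi> y = ((y\<^sup>2 - x\<^sup>2) / (2 * y)) powr (2 * \<alpha> - 1) *
        hypergeo_2F1 (\<alpha> + (\<nu> - 1) / 2) \<alpha> (2 * \<alpha>) (1 - x\<^sup>2 / y\<^sup>2) * f y" for y
  have "set_borel_measurable borel {x<..} \<Phi>"
  proof -
    have [measurable]: "(\<lambda>y. indicator {0<..} y *\<^sub>R f y) \<in> borel_measurable borel"
      using f by (simp add: set_borel_measurable_def)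
    have "(\<lambda>y. indicator {x<..} y * (((y\<^sup>2 - x\<^sup>2) / (2 * y)) powr (2 * \<alpha> - 1) *
        hypergeo_2F1 (\<alpha> + (\<nu> - 1) / 2) \<alpha> (2 * \<alpha>) (1 - x\<^sup>2 / y\<^sup>2)) * (indicator {0<..} y *\<^sub>R f y)) \<in> borel_measurable borel"
      by measurable
    also have "(\<lambda>y. indicator {x<..} y * (((y\<^sup>2 - x\<^sup>2) / (2 * y)) powr (2 * \<alpha> - 1) *
        hypergeo_2F1 (\<alpha> + (\<nu> - 1) / 2) \<alpha> (2 * \<alpha>) (1 - x\<^sup>2 / y\<^sup>2)) * (indicator {0<..} y *\<^sub>R f y))
       = (\<lambda>y. indicator {x<..} y *\<^sub>R \<Phi> y)"
      using x by (auto simp: \<Phi>_def indicator_def fun_eq_iff)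
    finally show ?thesis by (simp add: set_borel_measurable_def)
  qed
  note subst = lborel_integral_exp_substitution[OF x this]
  have "bessel_frac_integral \<nu> \<alpha> f x = 1 / Gamma (2 * \<alpha>) * (LBINT y:{x<..}. \<Phi> y)"
    by (simp only: bessel_frac_integral_def \<Phi>_def)
  then have "bessel_frac_integral \<nu> \<alpha> f x =
      1 / Gamma (2 * \<alpha>) * (LBINT s:{0<..}. x * exp (s / 2) / 2 * \<Phi> (x * exp (s / 2)))"
    by (simp only: subst)
  also have "(LBINT s:{0<..}. x * exp (s / 2) / 2 * \<Phi> (x * exp (s / 2)))
      = (\<integral>s. (Gamma (2 * \<alpha>) * x powr (2 * \<alpha>)) * (bessel_kernel \<nu> \<alpha> s * f (x * exp (s / 2))) \<partial>lborel)"
    unfolding set_lebesgue_integral_def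
  proof (rule Bochner_Integration.integral_cong[OF refl])
    fix s
    show "indicator {0<..} s *\<^sub>R (x * exp (s / 2) / 2 * \<Phi> (x * exp (s / 2))) =
        Gamma (2 * \<alpha>) * x powr (2 * \<alpha>) * (bessel_kernel \<nu> \<alpha> s * f (x * exp (s / 2)))"
    proof (cases "s > 0")
      case False
      then show ?thesis by (simp add: bessel_kernel_eq_0)
    next
      case True
      define w where "w = 1 - exp (- s)"
      \<comment> \<open>P = y / 2 is both the Jacobian dy/ds and the factor in (y^2 - x^2) / (2 y) =
        P w. Together they give P^(2 \<alpha>), the source of x^(2 \<alpha>), exp (\<alpha> s) and
        (1/4)^\<alpha>.\<close>
      define P where "P = x * exp (s / 2) / 2"
      have w: "w > 0" using True by (simp add: w_def)
      have P: "P > 0" using x by (simp add: P_def)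
      have e: "(exp (s / 2))\<^sup>2 = exp s" by (simp add: power2_eq_square exp_add[symmetric])
      have 1: "((x * exp (s / 2))\<^sup>2 - x\<^sup>2) / (2 * (x * exp (s / 2))) = P * w"
      proof -
        have "x\<^sup>2 = x\<^sup>2 * exp s * exp (- s)" by (simp add: mult.assoc flip: exp_add)
        then have "(x * exp (s / 2))\<^sup>2 - x\<^sup>2 = (x * exp (s / 2))\<^sup>2 * w"
          unfolding w_def power_mult_distrib e right_diff_distrib by simp
        also have "\<dots> / (2 * (x * exp (s / 2))) = (x * exp (s / 2)) / 2 * w"
          using x unfolding power2_eq_square by simp
        finally show ?thesis unfolding P_def .
      qed
      have 2: "1 - x\<^sup>2 / (x * exp (s / 2))\<^sup>2 = w"
        unfolding w_def power_mult_distrib e using x by (simp add: exp_minus inverse_eq_divide)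
      have "P * (P * w) powr (2 * \<alpha> - 1) = (P powr 1 * P powr (2 * \<alpha> - 1)) * w powr (2 * \<alpha> - 1)"
        using P w by (simp add: powr_mult)
      also have "P powr 1 * P powr (2 * \<alpha> - 1) = P powr (2 * \<alpha>)"
        by (simp only: powr_add[symmetric]) simp
      also have "P powr (2 * \<alpha>) = x powr (2 * \<alpha>) * exp (s / 2) powr (2 * \<alpha>) / 2 powr (2 * \<alpha>)"
        unfolding P_def using x by (subst powr_divide, simp, simp, subst powr_mult, simp_all)
      also have "\<dots> = x powr (2 * \<alpha>) * (exp (\<alpha> * s) * (1/4) powr \<alpha>)"
      proof -
        have 3: "exp (s / 2) powr (2 * \<alpha>) = exp (\<alpha> * s)"
          by (simp add: exp_powr_real mult.commute)
        have "(2::real) powr (2 * \<alpha>) = (2 powr 2) powr \<alpha>" by (simp only: powr_powr)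
        then have 4: "(1/4::real) powr \<alpha> = 1 / 2 powr (2 * \<alpha>)" by (simp add: powr_divide)
        show ?thesis unfolding 3 4 by (simp only: times_divide_eq_right mult_1_right)
      qed
      finally have 5: "P * (P * w) powr (2 * \<alpha> - 1) =
        x powr (2 * \<alpha>) * (exp (\<alpha> * s) * (1/4) powr \<alpha>) * w powr (2 * \<alpha> - 1)" .
      define H where "H = hypergeo_2F1 (\<alpha> + (\<nu> - 1) / 2) \<alpha> (2 * \<alpha>) w"
      have "bessel_kernel \<nu> \<alpha> s = (1/4) powr \<alpha> * (exp (\<alpha> * s) * (w powr (2 * \<alpha> - 1) / Gamma (2 * \<alpha>) * H))"
      proof -
        have "\<alpha> + 0 - - ((\<nu> - 1) / 2) = \<alpha> + (\<nu> - 1) / 2" "\<alpha> + \<alpha> = 2 * \<alpha>" "exp (- 0 * s) = 1" by simp_all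
        then show ?thesis
          using True unfolding bessel_kernel_def ek_conv_def H_def w_def by (simp only: if_True mult_1_left)
      qed
      then have "Gamma (2 * \<alpha>) * x powr (2 * \<alpha>) * (bessel_kernel \<nu> \<alpha> s * f (x * exp (s / 2)))
          = (x powr (2 * \<alpha>) * (exp (\<alpha> * s) * (1/4) powr \<alpha>) * w powr (2 * \<alpha> - 1)) * H * f (x * exp (s / 2))"
        using G by simp
      also have "\<dots> = P * \<Phi> (x * exp (s / 2))"
        unfolding 5[symmetric] \<Phi>_def 1 2 H_def by (simp only: mult.assoc)
      finally show ?thesis using True by (simp add: P_def)
    qed
  qed
  also have "1 / Gamma (2 * \<alpha>) * (\<integral>s. (Gamma (2 * \<alpha>) * x powr (2 * \<alpha>)) * (bessel_kernel \<nu> \<alpha> s * f (x * exp (s / 2))) \<partial>lborel)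
     = x powr (2 * \<alpha>) * (\<integral>s. bessel_kernel \<nu> \<alpha> s * f (x * exp (s / 2)) \<partial>lborel)"
    using G by (subst integral_mult_right_zero) simp
  finally show ?thesis .
qed

section \<open>The semigroup of fractional integrals\<close>


text \<open>A class whose invariance under the fractional integral follows from dominated
  convergence, without differentiating. Nothing is asked near 0, which integrals over (x,
  \<infinity>) with x > 0 never reach.\<close>

definition cont_vanishing :: "real \<Rightarrow> (real \<Rightarrow> real) \<Rightarrow> bool" where
  "cont_vanishing b g \<longleftrightarrow> continuous_on {0<..} g \<and> (\<forall>y>b. g y = 0)"

lemma cont_vanishing_measurable:
  "cont_vanishing b g \<Longrightarrow> set_borel_measurable borel {0<..} g"
  unfolding cont_vanishing_def set_borel_measurable_def
  by (intro borel_measurable_continuous_on_indicator) auto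

lemma cont_vanishing_exp_measurable:
  assumes "cont_vanishing b g" "x > 0"
  shows "(\<lambda>s. g (x * exp (s / 2))) \<in> borel_measurable borel"
proof (rule borel_measurable_continuous_onI)
  have exp_cont: "continuous_on UNIV (\<lambda>s::real. x * exp (s / 2))"
    by (intro continuous_on_mult continuous_on_const continuous_on_exp continuous_on_divide continuous_on_id) simp
  have g_cont: "continuous_on {0<..} g" using assms(1) by (simp add: cont_vanishing_def)
  show "continuous_on UNIV (\<lambda>s. g (x * exp (s / 2)))"
    by (rule continuous_on_compose2[OF g_cont exp_cont]) (use assms(2) in auto)
qed

lemma cont_vanishing_bounded:
  assumes "cont_vanishing b g" "x > 0"
  obtains C where "C \<ge> 0" "\<And>y. y \<ge> x \<Longrightarrow> \<bar>g y\<bar> \<le> C"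
proof -
  have "continuous_on {0<..} g" using assms(1) by (simp add: cont_vanishing_def)
  then have "continuous_on {x..b} g" by (rule continuous_on_subset) (use assms(2) in auto)
  then have "compact (g ` {x..b})" by (rule compact_continuous_image) simp
  then have "bounded (g ` {x..b})" by (rule compact_imp_bounded)
  then obtain C where C: "\<And>z. z \<in> g ` {x..b} \<Longrightarrow> \<bar>z\<bar> \<le> C"
    unfolding bounded_real by blast
  have "\<bar>g y\<bar> \<le> max C 0" if "y \<ge> x" for y
  proof (cases "y \<le> b")
    case True
    then have "\<bar>g y\<bar> \<le> C" using that by (intro C) auto
    then show ?thesis by simp
  next
    case False
    then show ?thesis using assms by (simp add: cont_vanishing_def)
  qed
  then show ?thesis using that[of "max C 0"] by simp
qed

text \<open>One dominating function serves all x \<ge> c: there g is bounded, and the integrand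
  vanishes for large s, so the truncated kernel suffices.\<close>

lemma cont_vanishing_dominated:
  assumes g: "cont_vanishing b g" and \<alpha>: "\<alpha> > 0" and c: "c > 0" and b: "b > 0"
  obtains D where "integrable lborel D"
    "\<And>x s. x \<ge> c \<Longrightarrow> \<bar>bessel_kernel \<nu> \<alpha> s * g (x * exp (s / 2))\<bar> \<le> D s"
proof -
  obtain C where C: "C \<ge> 0" "\<And>y. y \<ge> c \<Longrightarrow> \<bar>g y\<bar> \<le> C"
    using cont_vanishing_bounded[OF g c] by blast
  \<comment> \<open>For s > S and x \<ge> c the point x exp (s / 2) lies beyond b.\<close>
  define S where "S = 2 * ln (b / c)"
  define D where "D s = C * (bessel_kernel \<nu> \<alpha> s * indicator {..S} s)" for s
  show ?thesis
  proof
    show "integrable lborel D"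
      unfolding D_def[abs_def] by (intro integrable_mult_right integrable_bessel_kernel_atMost \<alpha>)
    fix x s assume x: "x \<ge> c"
    consider "s \<le> 0" | "0 < s" "s \<le> S" | "S < s" by linarith
    then show "\<bar>bessel_kernel \<nu> \<alpha> s * g (x * exp (s / 2))\<bar> \<le> D s"
    proof cases
      case 1
      then show ?thesis by (simp add: bessel_kernel_eq_0 D_def)
    next
      case 2
      have "x * exp (s / 2) \<ge> c * 1"
        using x c 2 by (intro mult_mono) auto
      then have "\<bar>g (x * exp (s / 2))\<bar> \<le> C" by (intro C) simp
      then have "bessel_kernel \<nu> \<alpha> s * \<bar>g (x * exp (s / 2))\<bar> \<le> bessel_kernel \<nu> \<alpha> s * C"
        using \<alpha> by (intro mult_left_mono bessel_kernel_nonneg)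
      then show ?thesis using 2 \<alpha> by (simp add: D_def abs_mult bessel_kernel_nonneg mult.commute)
    next
      case 3
      then have "ln (b / c) < s / 2" by (simp add: S_def)
      then have "exp (ln (b / c)) < exp (s / 2)" by (subst exp_less_cancel_iff)
      then have "b / c < exp (s / 2)" using b c by simp
      then have "b < c * exp (s / 2)" using c by (simp add: field_simps)
      also have "\<dots> \<le> x * exp (s / 2)" using x by (intro mult_right_mono) auto
      finally have "g (x * exp (s / 2)) = 0" using g by (simp add: cont_vanishing_def)
      then show ?thesis using C(1) \<alpha> by (simp add: D_def bessel_kernel_nonneg)
    qed
  qed
qed

lemma integrable_bessel_kernel_cont_vanishing:
  assumes g: "cont_vanishing b g" and \<alpha>: "\<alpha> > 0" and x: "x > 0" and b: "b > 0"
  shows "integrable lborel (\<lambda>s. bessel_kernel \<nu> \<alpha> s * g (x * exp (s / 2)))"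
proof -
  note [measurable] = cont_vanishing_exp_measurable[OF g x]
  obtain D where D: "integrable lborel D"
    "\<And>s. \<bar>bessel_kernel \<nu> \<alpha> s * g (x * exp (s / 2))\<bar> \<le> D s"
    using cont_vanishing_dominated[OF g \<alpha> x b, of \<nu>] by (metis order_refl)
  have "\<bar>bessel_kernel \<nu> \<alpha> s * g (x * exp (s / 2))\<bar> \<le> \<bar>D s\<bar>" for s
    using D(2)[of s] abs_ge_self order_trans by blast
  then show ?thesis
    by (intro Bochner_Integration.integrable_bound[OF D(1)]) auto
qed

text \<open>Dominated convergence gives continuity on each (c, \<infinity>) with a bound depending
  on c. The vanishing is inherited because only points x exp (s / 2) with s > 0 are
  evaluated.\<close>

lemma cont_vanishing_bessel_frac_integral:
  assumes g: "cont_vanishing b g" and \<alpha>: "\<alpha> > 0" and b: "b > 0"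
  shows "cont_vanishing b (bessel_frac_integral \<nu> \<alpha> g)"
proof -
  define J where "J x = (\<integral>s. bessel_kernel \<nu> \<alpha> s * g (x * exp (s / 2)) \<partial>lborel)" for x
  have eq: "bessel_frac_integral \<nu> \<alpha> g x = x powr (2 * \<alpha>) * J x" if "x > 0" for x
    using bessel_frac_integral_eq[OF \<alpha> that cont_vanishing_measurable[OF g]] by (simp add: J_def)
  have J_cont: "continuous_on {c<..} J" if c: "c > 0" for c
  proof -
    obtain D where D: "integrable lborel D"
      "\<And>x s. x \<ge> c \<Longrightarrow> \<bar>bessel_kernel \<nu> \<alpha> s * g (x * exp (s / 2))\<bar> \<le> D s"
      using cont_vanishing_dominated[OF g \<alpha> c b, of \<nu>] by blast
    show ?thesis
      unfolding continuous_on_sequentially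
    proof (intro allI ballI impI)
      fix u x assume x: "x \<in> {c<..}" and u: "(\<forall>n. u n \<in> {c<..}) \<and> u \<longlonglongrightarrow> x"
      have pos: "x > 0" "u n > 0" for n using x u c by (auto intro: less_trans)
      note [measurable] = cont_vanishing_exp_measurable[OF g pos(1)] cont_vanishing_exp_measurable[OF g pos(2)]
      have "(\<lambda>n. \<integral>s. bessel_kernel \<nu> \<alpha> s * g (u n * exp (s / 2)) \<partial>lborel) \<longlonglongrightarrow>
          (\<integral>s. bessel_kernel \<nu> \<alpha> s * g (x * exp (s / 2)) \<partial>lborel)"
      proof (rule integral_dominated_convergence[OF _ _ D(1)])
        show "AE s in lborel. (\<lambda>n. bessel_kernel \<nu> \<alpha> s * g (u n * exp (s / 2))) \<longlonglongrightarrow>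
           bessel_kernel \<nu> \<alpha> s * g (x * exp (s / 2))"
        proof (intro AE_I2 tendsto_mult tendsto_const)
          fix s
          have "isCont g (x * exp (s / 2))"
            using g pos(1) by (auto simp: cont_vanishing_def continuous_on_eq_continuous_at)
          moreover have "(\<lambda>n. u n * exp (s / 2)) \<longlonglongrightarrow> x * exp (s / 2)"
            using u by (intro tendsto_mult) auto
          ultimately show "(\<lambda>n. g (u n * exp (s / 2))) \<longlonglongrightarrow> g (x * exp (s / 2))"
            by (rule isCont_tendsto_compose)
        qed
        show "AE s in lborel. norm (bessel_kernel \<nu> \<alpha> s * g (u n * exp (s / 2))) \<le> D s" for n
          using D(2)[of "u n"] u by (intro AE_I2) (auto simp: less_imp_le)
      qed measurable
      then show "(J \<circ> u) \<longlonglongrightarrow> J x" by (simp add: J_def o_def)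
    qed
  qed
  have "continuous_on {0<..} J"
    unfolding continuous_on_eq_continuous_at[OF open_greaterThan]
  proof
    fix x :: real assume "x \<in> {0<..}"
    then show "isCont J x"
      using J_cont[of "x / 2"] by (auto simp: continuous_on_eq_continuous_at)
  qed
  then have "continuous_on {0<..} (\<lambda>x. x powr (2 * \<alpha>) * J x)"
    by (intro continuous_intros) auto
  then have 1: "continuous_on {0<..} (bessel_frac_integral \<nu> \<alpha> g)"
    by (rule continuous_on_eq) (simp add: eq)
  have 2: "bessel_frac_integral \<nu> \<alpha> g y = 0" if "y > b" for y
  proof -
    have "y > 0" using that b by simp
    have "bessel_kernel \<nu> \<alpha> s * g (y * exp (s / 2)) = 0" for s
    proof (cases "s > 0")
      case True
      have "y * 1 \<le> y * exp (s / 2)" using \<open>y > 0\<close> True by (intro mult_left_mono) auto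
      then show ?thesis using that g by (simp add: cont_vanishing_def)
    qed (simp add: bessel_kernel_eq_0)
    then show ?thesis by (simp only: eq[OF \<open>y > 0\<close>] J_def) simp
  qed
  from 1 2 show ?thesis by (simp add: cont_vanishing_def)
qed

text \<open>Successive dilations by exp (r / 2) and exp (s / 2) become the translation h (r + s), so
  the iterated integral is one against the convolved kernel. The inner prefactor supplies the exp
  (\<beta> r) that \<open>econv_bessel_kernel\<close> expects.\<close>

theorem bessel_frac_integral_semigroup:
  assumes g: "cont_vanishing b g" and b: "b > 0" and \<alpha>: "\<alpha> > 0" and \<beta>: "\<beta> > 0" and x: "x > 0"
  shows "bessel_frac_integral \<nu> \<alpha> (bessel_frac_integral \<nu> \<beta> g) x = bessel_frac_integral \<nu> (\<alpha> + \<beta>) g x"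
proof -
  define h where "h t = g (x * exp (t / 2))" for t
  have h_meas [measurable]: "h \<in> borel_measurable borel"
    unfolding h_def[abs_def] by (rule cont_vanishing_exp_measurable[OF g x])
  have inner: "bessel_frac_integral \<nu> \<beta> g (x * exp (r / 2)) =
     x powr (2 * \<beta>) * (exp (\<beta> * r) * (\<integral>s. bessel_kernel \<nu> \<beta> s * h (r + s) \<partial>lborel))" for r
  proof -
    have "x * exp (r / 2) > 0" using x by simp
    then have "bessel_frac_integral \<nu> \<beta> g (x * exp (r / 2)) = (x * exp (r / 2)) powr (2 * \<beta>) *
        (\<integral>s. bessel_kernel \<nu> \<beta> s * g (x * exp (r / 2) * exp (s / 2)) \<partial>lborel)"
      by (rule bessel_frac_integral_eq[OF \<beta> _ cont_vanishing_measurable[OF g]])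
    also have "(x * exp (r / 2)) powr (2 * \<beta>) = x powr (2 * \<beta>) * exp (\<beta> * r)"
      by (simp add: powr_mult exp_powr_real mult.commute)
    also have "(\<integral>s. bessel_kernel \<nu> \<beta> s * g (x * exp (r / 2) * exp (s / 2)) \<partial>lborel)
        = (\<integral>s. bessel_kernel \<nu> \<beta> s * h (r + s) \<partial>lborel)"
      by (simp add: h_def mult.assoc add_divide_distrib flip: exp_add)
    finally show ?thesis by (simp only: mult.assoc)
  qed
  have "bessel_frac_integral \<nu> \<alpha> (bessel_frac_integral \<nu> \<beta> g) x = x powr (2 * \<alpha>) *
      (\<integral>r. bessel_kernel \<nu> \<alpha> r * bessel_frac_integral \<nu> \<beta> g (x * exp (r / 2)) \<partial>lborel)"
    by (rule bessel_frac_integral_eq[OF \<alpha> x cont_vanishing_measurable[OF cont_vanishing_bessel_frac_integral[OF g \<beta> b]]])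
  also have "(\<integral>r. bessel_kernel \<nu> \<alpha> r * bessel_frac_integral \<nu> \<beta> g (x * exp (r / 2)) \<partial>lborel) =
     (\<integral>r. x powr (2 * \<beta>) * ((exp (\<beta> * r) * bessel_kernel \<nu> \<alpha> r) * (\<integral>s. bessel_kernel \<nu> \<beta> s * h (r + s) \<partial>lborel)) \<partial>lborel)"
    unfolding inner by (simp only: ac_simps)
  also have "\<dots> = x powr (2 * \<beta>) * (\<integral>r. (exp (\<beta> * r) * bessel_kernel \<nu> \<alpha> r) * (\<integral>s. bessel_kernel \<nu> \<beta> s * h (r + s) \<partial>lborel) \<partial>lborel)"
    by (rule integral_mult_right_zero)
  also have "(\<integral>r. (exp (\<beta> * r) * bessel_kernel \<nu> \<alpha> r) * (\<integral>s. bessel_kernel \<nu> \<beta> s * h (r + s) \<partial>lborel) \<partial>lborel)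
     = (\<integral>s. bessel_kernel \<nu> (\<alpha> + \<beta>) s * h s \<partial>lborel)"
  proof (rule econv_integral)
    show "integrable lborel (\<lambda>s. bessel_kernel \<nu> (\<alpha> + \<beta>) s * h s)"
      unfolding h_def using \<alpha> \<beta> by (intro integrable_bessel_kernel_cont_vanishing[OF g _ x b]) simp
  qed (use \<alpha> \<beta> in \<open>auto simp: bessel_kernel_nonneg econv_bessel_kernel\<close>)
  also have "x powr (2 * \<alpha>) * (x powr (2 * \<beta>) * (\<integral>s. bessel_kernel \<nu> (\<alpha> + \<beta>) s * h s \<partial>lborel))
      = bessel_frac_integral \<nu> (\<alpha> + \<beta>) g x"
    using bessel_frac_integral_eq[OF _ x cont_vanishing_measurable[OF g], of "\<alpha> + \<beta>"] \<alpha> \<beta>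
    by (simp add: h_def powr_add distrib_left)
  finally show ?thesis .
qed

lemma bessel_frac_integral_cong:
  assumes "\<And>y. y > 0 \<Longrightarrow> f y = g y" "x > 0"
  shows "bessel_frac_integral \<nu> \<alpha> f x = bessel_frac_integral \<nu> \<alpha> g x"
  unfolding bessel_frac_integral_def using assms
  by (intro arg_cong2[where f = "(*)"] refl set_lebesgue_integral_cong) auto

section \<open>Integration of order one\<close>


text \<open>Below M this is the fundamental theorem of calculus. From M on, the integral is locally
  constant 0; the strict M > b provides the neighbourhood at y = M.\<close>

lemma cont_vanishing_tail_has_derivative:
  assumes h: "cont_vanishing b h" and M: "M > b" and y: "y > 0"
  shows "((\<lambda>t. integral {t..M} h) has_real_derivative - h y) (at y)"
proof -
  have h_cont: "continuous_on {0<..} h" using h by (simp add: cont_vanishing_def)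
  show ?thesis
  proof (cases "y < M")
    case True
    \<comment> \<open>A fixed base point below y turns the variable lower limit into a variable
      upper limit.\<close>
    define c where "c = y / 2"
    have c: "0 < c" "c < y" using y by (auto simp: c_def)
    have cont: "continuous_on {c..M} h"
      by (rule continuous_on_subset[OF h_cont]) (use c in auto)
    have "((\<lambda>t. integral {c..t} h) has_real_derivative h y) (at y within {c..M})"
      by (rule integral_has_real_derivative[OF cont]) (use c True in auto)
    then have "((\<lambda>t. integral {c..t} h) has_real_derivative h y) (at y)"
      using at_within_Icc_at[of c y M] c True by simp
    then have "((\<lambda>t. integral {c..M} h - integral {c..t} h) has_real_derivative 0 - h y) (at y)"
      by (intro derivative_intros) auto
    then have "((\<lambda>t. integral {c..M} h - integral {c..t} h) has_real_derivative - h y) (at y)"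
      by simp
    then show ?thesis
    proof (rule has_field_derivative_transform_within_open[of _ _ _ "{c<..<M}"])
      fix t assume t: "t \<in> {c<..<M}"
      have "integral {c..t} h + integral {t..M} h = integral {c..M} h"
        by (rule Henstock_Kurzweil_Integration.integral_combine)
           (use t cont in \<open>auto intro: integrable_continuous_real\<close>)
      then show "integral {c..M} h - integral {c..t} h = integral {t..M} h" by simp
    qed (use c True in auto)
  next
    case False
    have zero: "h t = 0" if "t > b" for t using h that by (simp add: cont_vanishing_def)
    have "((\<lambda>t. 0) has_real_derivative - h y) (at y)"
      using zero[of y] False M by simp
    then show ?thesis
    proof (rule has_field_derivative_transform_within_open[of _ _ _ "{b<..}"])
      fix t assume t: "t \<in> {b<..}"
      have "integral {t..M} h = integral {t..M} (\<lambda>_. 0)"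
        by (rule integral_cong) (use t zero in auto)
      then show "0 = integral {t..M} h" by simp
    qed (use False M in auto)
  qed
qed

lemma cont_vanishing_tail:
  assumes h: "cont_vanishing b h" and M: "M > b"
  shows "cont_vanishing b (\<lambda>t. integral {t..M} h)"
  unfolding cont_vanishing_def
proof
  show "continuous_on {0<..} (\<lambda>t. integral {t..M} h)"
    using cont_vanishing_tail_has_derivative[OF assms]
    by (intro continuous_at_imp_continuous_on) (auto intro: DERIV_isCont)
  have zero: "h t = 0" if "t > b" for t using h that by (simp add: cont_vanishing_def)
  show "\<forall>y>b. integral {y..M} h = 0"
  proof (intro allI impI)
    fix y assume "y > b"
    then have "integral {y..M} h = integral {y..M} (\<lambda>_. 0)"
      by (intro integral_cong) (use zero in auto)
    then show "integral {y..M} h = 0" by simp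
  qed
qed

lemma cont_vanishing_powr_mult:
  assumes "cont_vanishing b h"
  shows "cont_vanishing b (\<lambda>y. y powr p * h y)"
  using assms unfolding cont_vanishing_def by (auto intro!: continuous_intros)

lemma cont_vanishing_cmult:
  assumes "cont_vanishing b h"
  shows "cont_vanishing b (\<lambda>y. c * h y)"
  using assms unfolding cont_vanishing_def by (auto intro: continuous_on_mult_left)

text \<open>Translates back from s to y when the kernel has order one, where the power of 1 - exp (-
  s) disappears. The infinite range can be cut at any M > b.\<close>

lemma cont_vanishing_exp_integral:
  assumes h: "cont_vanishing b h" and M: "M > b" and x: "x > 0"
  shows "(\<integral>s. indicator {0<..} s * (x * exp (s / 2) / 2 * h (x * exp (s / 2))) \<partial>lborel) = integral {x..M} h"
proof -
  have h_cont: "continuous_on {0<..} h" using h by (simp add: cont_vanishing_def)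
  have zero: "h t = 0" if "t > b" for t using h that by (simp add: cont_vanishing_def)
  have hm: "(\<lambda>y. indicator {0<..} y *\<^sub>R h y) \<in> borel_measurable borel"
    using cont_vanishing_measurable[OF h] by (simp add: set_borel_measurable_def)
  have meas: "set_borel_measurable borel S h" if "S \<in> sets borel" "S \<subseteq> {0<..}" for S
  proof -
    have "(\<lambda>y. indicator S y *\<^sub>R (indicator {0<..} y *\<^sub>R h y)) \<in> borel_measurable borel"
      using that(1) hm by measurable
    also have "(\<lambda>y. indicator S y *\<^sub>R (indicator {0<..} y *\<^sub>R h y)) = (\<lambda>y. indicator S y *\<^sub>R h y)"
      using that(2) by (auto simp: indicator_def fun_eq_iff)
    finally show ?thesis by (simp add: set_borel_measurable_def)
  qed
  have m1: "set_borel_measurable borel {x<..} h" by (rule meas) (use x in auto)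
  have m2: "set_borel_measurable borel {x..M} h" by (rule meas) (use x in auto)
  have "(\<integral>s. indicator {0<..} s * (x * exp (s / 2) / 2 * h (x * exp (s / 2))) \<partial>lborel) = (LBINT y:{x<..}. h y)"
    by (subst lborel_integral_exp_substitution[OF x m1]) (simp add: set_lebesgue_integral_def)
  also have "\<dots> = (LBINT y:{x..M}. h y)"
    unfolding set_lebesgue_integral_def
  proof (rule integral_cong_AE)
    show "AE y in lborel. indicator {x<..} y *\<^sub>R h y = indicator {x..M} y *\<^sub>R h y"
      using AE_lborel_singleton[of x]
    proof eventually_elim
      case (elim y)
      then show ?case using zero[of y] M by (auto simp: indicator_def)
    qed
  qed (use m1 m2 in \<open>simp_all add: set_borel_measurable_def\<close>)
  also have "\<dots> = integral {x..M} h"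
  proof (rule set_borel_integral_eq_integral)
    show "set_integrable lborel {x..M} h"
      by (rule borel_integrable_atLeastAtMost', rule continuous_on_subset[OF h_cont]) (use x in auto)
  qed
  finally show ?thesis .
qed

text \<open>In order one both factors of the kernel are pure exponentials on s > 0, and each becomes
  a weighted tail integral. The result is the explicit inverse of B = y^(-\<nu>) D y^\<nu>
  D.\<close>

lemma bessel_frac_integral_1:
  assumes g: "cont_vanishing b g" and b: "b > 0" and M: "M > b" and x: "x > 0"
  shows "bessel_frac_integral \<nu> 1 g x =
    integral {x..M} (\<lambda>y. y powr (- \<nu>) * integral {y..M} (\<lambda>z. z powr \<nu> * g z))"
proof -
  define a where "a = - ((\<nu> - 1) / 2)"
  define P where "P y = integral {y..M} (\<lambda>z. z powr \<nu> * g z)" for y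
  define h where "h t = x\<^sup>2 / 4 * (exp t * g (x * exp (t / 2)))" for t
  have P: "cont_vanishing b P"
    unfolding P_def[abs_def] by (intro cont_vanishing_tail cont_vanishing_powr_mult g M)
  have h_meas [measurable]: "h \<in> borel_measurable borel"
    unfolding h_def[abs_def] using cont_vanishing_exp_measurable[OF g x] by measurable
  have kernel: "x powr 2 * (bessel_kernel \<nu> 1 s * g (x * exp (s / 2))) = ek_conv a 1 0 1 s * h s" for s
    using x by (simp add: bessel_kernel_def a_def h_def)
  have int: "integrable lborel (\<lambda>s. ek_conv a 1 0 1 s * h s)"
    unfolding kernel[symmetric]
    by (intro integrable_mult_right integrable_bessel_kernel_cont_vanishing[OF g _ x b]) simp
  have inner: "(\<integral>s. ek_kernel a 1 s * h (r + s) \<partial>lborel) = x * exp (r / 2) / 2 * ((x * exp (r / 2)) powr (- \<nu>) * P (x * exp (r / 2)))" for r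
  proof -
    define y where "y = x * exp (r / 2)"
    have y: "y > 0" using x by (simp add: y_def)
    \<comment> \<open>The constant is chosen so that, with u = exp (s / 2) and exp (- a s) =
      u^(\<nu> - 1), the integrand takes the form y u / 2 times \<open>h2 (y * u)\<close>.\<close>
    define h2 where "h2 z = y powr (1 - \<nu>) / 2 * (z powr \<nu> * g z)" for z
    have h2: "cont_vanishing b h2"
      unfolding h2_def[abs_def] by (intro cont_vanishing_cmult cont_vanishing_powr_mult g)
    have "ek_kernel a 1 s * h (r + s) = indicator {0<..} s * (y * exp (s / 2) / 2 * h2 (y * exp (s / 2)))" for s
    proof (cases "s > 0")
      case True
      define u where "u = exp (s / 2)"
      have u: "u > 0" by (simp add: u_def)
      have e1: "ek_kernel a 1 s = u powr (\<nu> - 1)"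
      proof -
        have "ek_kernel a 1 s = exp (- a * s)" using True by (simp add: ek_kernel_def)
        also have "- a * s = s / 2 * (\<nu> - 1)" by (simp add: a_def)
        finally show ?thesis by (simp only: u_def exp_powr_real)
      qed
      have e2: "h (r + s) = (y * u)\<^sup>2 / 4 * g (y * u)"
      proof -
        have "exp (r + s) = (exp (r / 2) * exp (s / 2))\<^sup>2"
          by (simp add: power2_eq_square flip: exp_add)
        moreover have "x * exp ((r + s) / 2) = y * u"
          by (simp add: y_def u_def add_divide_distrib exp_add)
        ultimately have "h (r + s) = x\<^sup>2 / 4 * ((exp (r / 2) * exp (s / 2))\<^sup>2 * g (y * u))"
          unfolding h_def by (simp only:)
        then show ?thesis by (simp add: y_def u_def power_mult_distrib)
      qed
      have e3: "y powr (1 - \<nu>) * (y * u) powr \<nu> = y * u powr \<nu>"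
        using y u by (simp add: powr_mult powr_diff)
      have e4: "u powr (\<nu> - 1) * u = u powr \<nu>"
        using u by (simp add: powr_diff)
      have "ek_kernel a 1 s * h (r + s) = (u powr (\<nu> - 1) * u) * u * y\<^sup>2 / 4 * g (y * u)"
        unfolding e1 e2 by (simp add: power2_eq_square)
      also have "\<dots> = y * u / 2 * ((y * u powr \<nu>) / 2 * g (y * u))"
        unfolding e4 by (simp add: power2_eq_square)
      also have "\<dots> = y * u / 2 * h2 (y * u)"
        unfolding h2_def e3[symmetric] by simp
      finally show ?thesis using True by (simp add: u_def)
    qed (simp add: ek_kernel_def)
    then have "(\<integral>s. ek_kernel a 1 s * h (r + s) \<partial>lborel) = integral {y..M} h2"
      using cont_vanishing_exp_integral[OF h2 M y] by (simp only:)
    also have "\<dots> = y powr (1 - \<nu>) / 2 * P y"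
      unfolding h2_def[abs_def] P_def by (rule integral_mult_right)
    also have "\<dots> = y / 2 * (y powr (- \<nu>) * P y)"
      using y by (simp add: powr_diff powr_minus_divide)
    finally show ?thesis by (simp add: y_def)
  qed
  have "bessel_frac_integral \<nu> 1 g x = x powr (2 * 1) * (\<integral>s. bessel_kernel \<nu> 1 s * g (x * exp (s / 2)) \<partial>lborel)"
    by (rule bessel_frac_integral_eq[OF _ x cont_vanishing_measurable[OF g]]) simp
  also have "\<dots> = (\<integral>s. ek_conv a 1 0 1 s * h s \<partial>lborel)"
    unfolding kernel[symmetric] by (subst integral_mult_right_zero) simp
  \<comment> \<open>The factor of index a is placed innermost, so that z^\<nu> enters the inner tail
    integral and y^(-\<nu>) the outer one.\<close>
  also have "\<dots> = (\<integral>r. ek_kernel 0 1 r * (\<integral>s. ek_kernel a 1 s * h (r + s) \<partial>lborel) \<partial>lborel)"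
  proof (rule econv_integral[symmetric])
    show "econv (ek_kernel 0 1) (ek_kernel a 1) s = ennreal (ek_conv a 1 0 1 s)" for s
      by (subst econv_commute) (simp_all add: econv_ek_kernel)
  qed (use int in \<open>auto simp: ek_kernel_nonneg econv_ek_kernel\<close>)
  also have "\<dots> = (\<integral>r. indicator {0<..} r * (x * exp (r / 2) / 2 * ((x * exp (r / 2)) powr (- \<nu>) * P (x * exp (r / 2)))) \<partial>lborel)"
    unfolding inner by (intro Bochner_Integration.integral_cong) (auto simp: ek_kernel_def indicator_def)
  also have "\<dots> = integral {x..M} (\<lambda>y. y powr (- \<nu>) * P y)"
    by (rule cont_vanishing_exp_integral[OF cont_vanishing_powr_mult[OF P] M x])
  finally show ?thesis by (simp add: P_def)
qed

section \<open>The Bessel operator inverts integration of order one\<close>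

lemma deriv_cong_halfline:
  assumes "\<And>y. y > (0::real) \<Longrightarrow> f y = g y" "x > 0"
  shows "deriv f x = deriv g x"
proof (rule deriv_cong_ev)
  show "\<forall>\<^sub>F y in nhds x. f y = g y"
    using eventually_nhds_in_open[of "{0<..}" x] assms by (auto elim: eventually_mono)
qed simp

lemma bessel_op_cong:
  assumes "\<And>y. y > 0 \<Longrightarrow> f y = g y" "x > 0"
  shows "bessel_op \<nu> f x = bessel_op \<nu> g x"
  unfolding bessel_op_def
  using deriv_cong_halfline[of f g] deriv_cong_halfline[of "deriv f" "deriv g"] assms by simp

text \<open>The first derivative is prescribed on the whole half-line because \<open>deriv U\<close>
  must agree with V near x before it is differentiated again.\<close>

lemma bessel_op_eqI:
  assumes U: "\<And>y. y > 0 \<Longrightarrow> (U has_real_derivative V y) (at y)"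
    and V: "(V has_real_derivative W) (at x)" and x: "x > 0"
  shows "bessel_op \<nu> U x = W + \<nu> / x * V x"
proof -
  have "deriv U y = V y" if "y > 0" for y using U[OF that] by (rule DERIV_imp_deriv)
  then have "deriv (deriv U) x = deriv V x" "deriv U x = V x"
    using deriv_cong_halfline[of "deriv U" V] x by auto
  then show ?thesis using DERIV_imp_deriv[OF V] by (simp add: bessel_op_def)
qed

text \<open>Two applications of the fundamental theorem; the two terms containing P cancel.
  Continuity of g is enough for this, which lets the lemma be applied to fractional
  integrals.\<close>

lemma bessel_op_bessel_frac_integral_1:
  assumes g: "cont_vanishing b g" and b: "b > 0" and x: "x > 0"
  shows "bessel_op \<nu> (bessel_frac_integral \<nu> 1 g) x = g x"
proof -
  define M where "M = b + 1"
  have M: "M > b" by (simp add: M_def)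
  define P where "P y = integral {y..M} (\<lambda>z. z powr \<nu> * g z)" for y
  define U where "U x = integral {x..M} (\<lambda>y. y powr (- \<nu>) * P y)" for x
  have g': "cont_vanishing b (\<lambda>z. z powr \<nu> * g z)" by (rule cont_vanishing_powr_mult[OF g])
  have P: "cont_vanishing b P" unfolding P_def[abs_def] by (rule cont_vanishing_tail[OF g' M])
  have P': "(P has_real_derivative - (x powr \<nu> * g x)) (at x)"
    unfolding P_def[abs_def] by (rule cont_vanishing_tail_has_derivative[OF g' M x])
  have U': "(U has_real_derivative - (y powr (- \<nu>) * P y)) (at y)" if "y > 0" for y
    unfolding U_def[abs_def] by (rule cont_vanishing_tail_has_derivative[OF cont_vanishing_powr_mult[OF P] M that])
  have "((\<lambda>y. y powr (- \<nu>)) has_real_derivative - \<nu> * x powr (- \<nu> - 1)) (at x)"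
    using has_real_derivative_powr[OF x, of "- \<nu>"] by simp
  then have V': "((\<lambda>y. - (y powr (- \<nu>) * P y)) has_real_derivative
      - ((- \<nu> * x powr (- \<nu> - 1)) * P x + (- (x powr \<nu> * g x)) * x powr (- \<nu>))) (at x)"
    by (intro DERIV_minus DERIV_mult P')
  have e1: "x powr (- \<nu> - 1) = x powr (- \<nu>) / x" using x by (simp add: powr_diff)
  have e2: "x powr \<nu> * x powr (- \<nu>) = 1" using x by (simp add: powr_add[symmetric])
  have "bessel_op \<nu> (bessel_frac_integral \<nu> 1 g) x = bessel_op \<nu> U x"
    by (rule bessel_op_cong[OF _ x]) (simp add: bessel_frac_integral_1[OF g b M] U_def P_def)
  also have "\<dots> = - ((- \<nu> * x powr (- \<nu> - 1)) * P x + (- (x powr \<nu> * g x)) * x powr (- \<nu>))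
      + \<nu> / x * - (x powr (- \<nu>) * P x)"
    by (rule bessel_op_eqI[OF U' V' x])
  also have "\<dots> = (x powr \<nu> * x powr (- \<nu>)) * g x"
    unfolding e1 by (simp add: algebra_simps)
  finally show ?thesis by (simp add: e2)
qed

text \<open>Since z^\<nu> B f is the derivative of z^\<nu> f', both tail integrals are evaluated by
  the fundamental theorem, and the boundary terms at M vanish.\<close>

lemma bessel_frac_integral_1_bessel_op:
  assumes f: "\<And>y. y > 0 \<Longrightarrow> (f has_real_derivative f' y) (at y)"
    and f': "\<And>y. y > 0 \<Longrightarrow> (f' has_real_derivative f'' y) (at y)"
    and f_zero: "\<And>y. y > b \<Longrightarrow> f y = 0" "\<And>y. y > b \<Longrightarrow> f' y = 0"
    and Bf: "cont_vanishing b (bessel_op \<nu> f)" and b: "b > 0" and x: "x > 0"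
  shows "bessel_frac_integral \<nu> 1 (bessel_op \<nu> f) x = f x"
proof -
  \<comment> \<open>Exceeding b kills the boundary terms; exceeding x keeps [x, M] nonempty when x >
    b.\<close>
  define M where "M = max b x + 1"
  have M: "M > b" "M > x" by (auto simp: M_def)
  have tail: "y powr (- \<nu>) * integral {y..M} (\<lambda>z. z powr \<nu> * bessel_op \<nu> f z) = - f' y"
    if y: "y > 0" "y \<le> M" for y
  proof -
    have "((\<lambda>z. z powr \<nu> * bessel_op \<nu> f z) has_integral (M powr \<nu> * f' M - y powr \<nu> * f' y)) {y..M}"
    proof (rule fundamental_theorem_of_calculus)
      fix z assume "z \<in> {y..M}"
      then have z: "z > 0" using y by simp
      have "((\<lambda>z. z powr \<nu> * f' z) has_real_derivative (\<nu> * z powr (\<nu> - 1)) * f' z + f'' z * z powr \<nu>) (at z)"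
        by (intro DERIV_mult has_real_derivative_powr z f')
      also have "(\<nu> * z powr (\<nu> - 1)) * f' z + f'' z * z powr \<nu> = z powr \<nu> * bessel_op \<nu> f z"
        using z by (simp add: bessel_op_eqI[OF f f'[OF z] z] powr_diff algebra_simps)
      finally show "((\<lambda>z. z powr \<nu> * f' z) has_vector_derivative z powr \<nu> * bessel_op \<nu> f z) (at z within {y..M})"
        by (simp add: has_real_derivative_iff_has_vector_derivative has_vector_derivative_at_within)
    qed (use y in auto)
    then have "integral {y..M} (\<lambda>z. z powr \<nu> * bessel_op \<nu> f z) = - (y powr \<nu> * f' y)"
      using f_zero(2)[OF M(1)] by (simp add: integral_unique)
    moreover have "y powr (- \<nu>) * y powr \<nu> = 1" using y by (simp add: powr_add[symmetric])
    ultimately show ?thesis by (simp add: mult.assoc[symmetric])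
  qed
  have "bessel_frac_integral \<nu> 1 (bessel_op \<nu> f) x = integral {x..M} (\<lambda>y. - f' y)"
    unfolding bessel_frac_integral_1[OF Bf b M(1) x]
    by (rule integral_cong) (use tail x in auto)
  also have "\<dots> = - f M - - f x"
  proof (rule integral_unique, rule fundamental_theorem_of_calculus)
    fix y assume "y \<in> {x..M}"
    then have "((\<lambda>y. - f y) has_real_derivative - f' y) (at y)"
      using x by (intro DERIV_minus f) auto
    then show "((\<lambda>y. - f y) has_vector_derivative - f' y) (at y within {x..M})"
      by (simp add: has_real_derivative_iff_has_vector_derivative has_vector_derivative_at_within)
  qed (use M in auto)
  also have "\<dots> = f x" using f_zero(1)[OF M(1)] by simp
  finally show ?thesis .
qed

section \<open>Smooth functions and fractional derivatives\<close>


text \<open>A finite-order version of smoothness that permits induction. Order n means n + 1 times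
  differentiable, so order 0 is plain differentiability.\<close>

definition diff_upto :: "nat \<Rightarrow> (real \<Rightarrow> real) \<Rightarrow> bool" where
  "diff_upto n f \<longleftrightarrow> (\<forall>k\<le>n. \<forall>x>0. ((deriv ^^ k) f) field_differentiable (at x))"

lemma smooth_iff_diff_upto: "smooth_on_halfline f \<longleftrightarrow> (\<forall>n. diff_upto n f)"
  by (auto simp: smooth_on_halfline_def diff_upto_def)

lemma diff_upto_0: "diff_upto 0 f \<longleftrightarrow> (\<forall>x>0. f field_differentiable (at x))"
  by (simp add: diff_upto_def)

text \<open>Peels off the innermost derivative, so that inductions can apply the sum and product
  rules to \<open>deriv f\<close>.\<close>

lemma diff_upto_Suc: "diff_upto (Suc n) f \<longleftrightarrow> diff_upto 0 f \<and> diff_upto n (deriv f)"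
proof -
  have funpow: "(deriv ^^ Suc k) f = (deriv ^^ k) (deriv f)" for k
    by (simp only: funpow_Suc_right o_def)
  have split: "(\<forall>k\<le>Suc n. Q k) \<longleftrightarrow> Q 0 \<and> (\<forall>k\<le>n. Q (Suc k))" for Q
    using All_less_Suc2[of "Suc n" Q] by (simp only: less_Suc_eq_le)
  show ?thesis unfolding diff_upto_def split funpow by simp
qed

lemma diff_upto_Suc_imp: "diff_upto (Suc n) f \<Longrightarrow> diff_upto n f"
  by (simp add: diff_upto_def)

lemma diff_upto_imp_0: "diff_upto n f \<Longrightarrow> diff_upto 0 f"
  unfolding diff_upto_def by blast

lemma field_differentiable_cong_halfline:
  assumes "\<And>y. y > (0::real) \<Longrightarrow> f y = g y" "x > 0" "f field_differentiable at x"
  shows "g field_differentiable at x"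
proof -
  obtain D where "(f has_field_derivative D) (at x)"
    using assms(3) by (auto simp: field_differentiable_def)
  then have "(g has_field_derivative D) (at x)"
    by (rule has_field_derivative_transform_within_open[of _ _ _ "{0<..}"]) (use assms in auto)
  then show ?thesis by (auto simp: field_differentiable_def)
qed

text \<open>Derivatives are local and the half-line is open. This matters because derivative
  formulas are available only for positive arguments.\<close>

lemma diff_upto_cong:
  assumes "\<And>y. y > 0 \<Longrightarrow> f y = g y" "diff_upto n f"
  shows "diff_upto n g"
  using assms
proof (induction n arbitrary: f g)
  case 0
  then show ?case unfolding diff_upto_0 using field_differentiable_cong_halfline[of f g] by blast
next
  case (Suc n)
  then have "diff_upto 0 g"
    unfolding diff_upto_Suc diff_upto_0 using field_differentiable_cong_halfline[of f g] by blast
  moreover have "diff_upto n (deriv g)"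
    by (rule Suc.IH[of "deriv f"]) (use Suc.prems deriv_cong_halfline[of f g] in \<open>auto simp: diff_upto_Suc\<close>)
  ultimately show ?case by (simp add: diff_upto_Suc)
qed

lemma diff_upto_add:
  assumes "diff_upto n f" "diff_upto n g"
  shows "diff_upto n (\<lambda>x. f x + g x)"
  using assms
proof (induction n arbitrary: f g)
  case 0
  then show ?case by (simp add: diff_upto_0 field_differentiable_add)
next
  case (Suc n)
  have d: "f field_differentiable at x" "g field_differentiable at x" if "x > 0" for x
    using Suc.prems that by (auto simp: diff_upto_Suc diff_upto_0)
  have "diff_upto n (\<lambda>x. deriv f x + deriv g x)"
    using Suc.prems by (intro Suc.IH) (auto simp: diff_upto_Suc)
  then have "diff_upto n (deriv (\<lambda>x. f x + g x))"
    by (rule diff_upto_cong[rotated]) (simp add: d)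
  then show ?case using d by (simp add: diff_upto_Suc diff_upto_0 field_differentiable_add)
qed

lemma diff_upto_mult:
  assumes "diff_upto n f" "diff_upto n g"
  shows "diff_upto n (\<lambda>x. f x * g x)"
  using assms
proof (induction n arbitrary: f g)
  case 0
  then show ?case by (simp add: diff_upto_0 field_differentiable_mult)
next
  case (Suc n)
  have d: "f field_differentiable at x" "g field_differentiable at x" if "x > 0" for x
    using Suc.prems that by (auto simp: diff_upto_Suc diff_upto_0)
  have "diff_upto n (\<lambda>x. f x * deriv g x + deriv f x * g x)"
    using Suc.prems diff_upto_Suc_imp[OF Suc.prems(1)] diff_upto_Suc_imp[OF Suc.prems(2)]
    by (intro diff_upto_add Suc.IH) (auto simp: diff_upto_Suc)
  then have "diff_upto n (deriv (\<lambda>x. f x * g x))"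
    by (rule diff_upto_cong[rotated]) (simp add: d)
  then show ?case using d by (simp add: diff_upto_Suc diff_upto_0 field_differentiable_mult)
qed

lemma diff_upto_const: "diff_upto n (\<lambda>x. c)"
proof -
  have "(deriv ^^ k) (\<lambda>x::real. c) = (\<lambda>x. if k = 0 then c else 0)" for k
  proof (induction k)
    case (Suc k)
    have "(deriv ^^ Suc k) (\<lambda>x::real. c) = deriv (\<lambda>x. if k = 0 then c else 0)"
      by (simp add: Suc.IH)
    then show ?case by (cases "k = 0") (simp_all add: fun_eq_iff)
  qed simp
  then show ?thesis by (simp add: diff_upto_def)
qed

text \<open>The derivative -1/x^2 is a product of constants and \<open>inverse\<close> itself, so
  the induction closes.\<close>

lemma diff_upto_inverse: "diff_upto n inverse"
proof (induction n)
  case 0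
  then show ?case by (auto simp: diff_upto_0 intro!: field_differentiable_inverse field_differentiable_ident)
next
  case (Suc n)
  have "diff_upto n (\<lambda>x. (-1) * (inverse x * inverse x))"
    by (intro diff_upto_mult Suc.IH diff_upto_const)
  then have "diff_upto n (deriv inverse)"
  proof (rule diff_upto_cong[rotated])
    fix y :: real assume y: "y > 0"
    have "(inverse has_real_derivative - (inverse y ^ Suc (Suc 0))) (at y)"
      by (rule DERIV_inverse) (use y in simp)
    then show "- 1 * (inverse y * inverse y) = deriv inverse y"
      by (simp add: DERIV_imp_deriv)
  qed
  then show ?case using diff_upto_imp_0[OF Suc.IH] by (simp add: diff_upto_Suc)
qed

lemma smooth_deriv: "smooth_on_halfline f \<Longrightarrow> smooth_on_halfline (deriv f)"
  using diff_upto_Suc unfolding smooth_iff_diff_upto by blast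

lemma smooth_DERIV:
  assumes "smooth_on_halfline f" "x > 0"
  shows "(f has_real_derivative deriv f x) (at x)"
  using assms diff_upto_0 unfolding smooth_iff_diff_upto DERIV_deriv_iff_field_differentiable by blast

lemma smooth_continuous_on: "smooth_on_halfline f \<Longrightarrow> continuous_on {0<..} f"
  by (intro continuous_at_imp_continuous_on) (auto intro: DERIV_isCont smooth_DERIV)

lemma smooth_bessel_op:
  assumes "smooth_on_halfline f"
  shows "smooth_on_halfline (bessel_op \<nu> f)"
proof -
  have "diff_upto n (\<lambda>x. deriv (deriv f) x + (\<nu> * inverse x) * deriv f x)" for n
    using smooth_deriv[OF assms] smooth_deriv[OF smooth_deriv[OF assms]]
    by (intro diff_upto_add diff_upto_mult diff_upto_const diff_upto_inverse) (auto simp: smooth_iff_diff_upto)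
  then show ?thesis by (simp add: smooth_iff_diff_upto bessel_op_def divide_inverse)
qed

section \<open>Smooth functions vanishing beyond b\<close>

definition smooth_vanishing :: "real \<Rightarrow> (real \<Rightarrow> real) \<Rightarrow> bool" where
  "smooth_vanishing b f \<longleftrightarrow> smooth_on_halfline f \<and> (\<forall>y>b. f y = 0)"

lemma smooth_vanishing_imp_cont: "smooth_vanishing b f \<Longrightarrow> cont_vanishing b f"
  by (simp add: smooth_vanishing_def cont_vanishing_def smooth_continuous_on)

lemma smooth_vanishing_deriv:
  assumes "smooth_vanishing b f"
  shows "smooth_vanishing b (deriv f)"
proof -
  have "deriv f y = 0" if "y > b" for y
  proof -
    have "deriv f y = deriv (\<lambda>_. 0) y"
    proof (rule deriv_cong_ev)
      show "\<forall>\<^sub>F t in nhds y. f t = 0"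
        using eventually_nhds_in_open[of "{b<..}" y] that assms
        by (auto simp: smooth_vanishing_def elim: eventually_mono)
    qed simp
    then show ?thesis by simp
  qed
  then show ?thesis using assms by (simp add: smooth_vanishing_def smooth_deriv)
qed

lemma smooth_vanishing_bessel_op:
  assumes "smooth_vanishing b f"
  shows "smooth_vanishing b (bessel_op \<nu> f)"
  using assms smooth_vanishing_deriv[OF assms] smooth_vanishing_deriv[OF smooth_vanishing_deriv[OF assms]]
    smooth_bessel_op[of f \<nu>]
  by (simp add: smooth_vanishing_def) (simp add: bessel_op_def)

lemma smooth_vanishing_bessel_op_funpow:
  "smooth_vanishing b f \<Longrightarrow> smooth_vanishing b ((bessel_op \<nu> ^^ n) f)"
  by (induction n) (auto intro: smooth_vanishing_bessel_op)

lemma bessel_op_funpow_cong: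
  assumes "\<And>y. y > 0 \<Longrightarrow> f y = g y" "x > 0"
  shows "(bessel_op \<nu> ^^ n) f x = (bessel_op \<nu> ^^ n) g x"
  using assms(2)
proof (induction n arbitrary: x)
  case 0
  then show ?case using assms by simp
next
  case (Suc n)
  then show ?case using bessel_op_cong[OF Suc.IH] by simp
qed

lemma bessel_frac_integral_1_bessel_op_smooth:
  assumes f: "smooth_vanishing b f" and b: "b > 0" and x: "x > 0"
  shows "bessel_frac_integral \<nu> 1 (bessel_op \<nu> f) x = f x"
proof (rule bessel_frac_integral_1_bessel_op)
  have s: "smooth_on_halfline f" using f by (simp add: smooth_vanishing_def)
  show "(f has_real_derivative deriv f y) (at y)" "(deriv f has_real_derivative deriv (deriv f) y) (at y)"
    if "y > 0" for y
    using that s by (auto intro: smooth_DERIV smooth_deriv)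
  show "f y = 0" "deriv f y = 0" if "y > b" for y
    using f smooth_vanishing_deriv[OF f] that by (auto simp: smooth_vanishing_def)
  show "cont_vanishing b (bessel_op \<nu> f)"
    by (intro smooth_vanishing_imp_cont smooth_vanishing_bessel_op f)
qed (use b x in auto)

section \<open>Commutation and the semigroup of fractional derivatives\<close>

lemma bessel_op_bessel_frac_integral_commute:
  assumes f: "smooth_vanishing b f" and b: "b > 0" and \<alpha>: "\<alpha> > 0" and x: "x > 0"
  shows "bessel_op \<nu> (bessel_frac_integral \<nu> \<alpha> f) x = bessel_frac_integral \<nu> \<alpha> (bessel_op \<nu> f) x"
proof -
  have Bf: "cont_vanishing b (bessel_op \<nu> f)"
    by (intro smooth_vanishing_imp_cont smooth_vanishing_bessel_op f)
  have "bessel_frac_integral \<nu> \<alpha> f y = bessel_frac_integral \<nu> 1 (bessel_frac_integral \<nu> \<alpha> (bessel_op \<nu> f)) y"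
    if y: "y > 0" for y
  proof -
    have "bessel_frac_integral \<nu> \<alpha> f y = bessel_frac_integral \<nu> \<alpha> (bessel_frac_integral \<nu> 1 (bessel_op \<nu> f)) y"
      by (rule bessel_frac_integral_cong[OF _ y]) (simp add: bessel_frac_integral_1_bessel_op_smooth[OF f b])
    also have "\<dots> = bessel_frac_integral \<nu> (\<alpha> + 1) (bessel_op \<nu> f) y"
      by (rule bessel_frac_integral_semigroup[OF Bf b \<alpha> _ y]) simp
    also have "\<dots> = bessel_frac_integral \<nu> 1 (bessel_frac_integral \<nu> \<alpha> (bessel_op \<nu> f)) y"
      using bessel_frac_integral_semigroup[OF Bf b _ \<alpha> y, of 1] by (simp add: add.commute)
    finally show ?thesis .
  qed
  then have "bessel_op \<nu> (bessel_frac_integral \<nu> \<alpha> f) x =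
      bessel_op \<nu> (bessel_frac_integral \<nu> 1 (bessel_frac_integral \<nu> \<alpha> (bessel_op \<nu> f))) x"
    by (rule bessel_op_cong[OF _ x])
  also have "\<dots> = bessel_frac_integral \<nu> \<alpha> (bessel_op \<nu> f) x"
    by (rule bessel_op_bessel_frac_integral_1[OF cont_vanishing_bessel_frac_integral[OF Bf \<alpha> b] b x])
  finally show ?thesis .
qed

lemma bessel_op_funpow_bessel_frac_integral_commute:
  assumes f: "smooth_vanishing b f" and b: "b > 0" and \<alpha>: "\<alpha> > 0" and x: "x > 0"
  shows "(bessel_op \<nu> ^^ n) (bessel_frac_integral \<nu> \<alpha> f) x = bessel_frac_integral \<nu> \<alpha> ((bessel_op \<nu> ^^ n) f) x"
  using x
proof (induction n arbitrary: x)
  case (Suc n)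
  then have "(bessel_op \<nu> ^^ Suc n) (bessel_frac_integral \<nu> \<alpha> f) x =
      bessel_op \<nu> (bessel_frac_integral \<nu> \<alpha> ((bessel_op \<nu> ^^ n) f)) x"
    using bessel_op_cong[OF Suc.IH] by simp
  also have "\<dots> = bessel_frac_integral \<nu> \<alpha> ((bessel_op \<nu> ^^ Suc n) f) x"
    using bessel_op_bessel_frac_integral_commute[OF smooth_vanishing_bessel_op_funpow[OF f] b \<alpha> Suc.prems]
    by simp
  finally show ?case .
qed simp

text \<open>Each additional order of integration cancels one factor B through I^1 B = id.\<close>

lemma bessel_frac_integral_add_nat_bessel_op_funpow:
  assumes f: "smooth_vanishing b f" and b: "b > 0" and \<gamma>: "\<gamma> > 0" and x: "x > 0"
  shows "bessel_frac_integral \<nu> (\<gamma> + real k) ((bessel_op \<nu> ^^ k) f) x = bessel_frac_integral \<nu> \<gamma> f x"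
proof (induction k)
  case (Suc k)
  let ?g = "(bessel_op \<nu> ^^ k) f"
  have g: "smooth_vanishing b ?g" by (rule smooth_vanishing_bessel_op_funpow[OF f])
  have "bessel_frac_integral \<nu> (\<gamma> + real (Suc k)) ((bessel_op \<nu> ^^ Suc k) f) x
      = bessel_frac_integral \<nu> ((\<gamma> + real k) + 1) (bessel_op \<nu> ?g) x"
    by (simp add: add_ac)
  also have "\<dots> = bessel_frac_integral \<nu> (\<gamma> + real k) (bessel_frac_integral \<nu> 1 (bessel_op \<nu> ?g)) x"
    by (rule bessel_frac_integral_semigroup[symmetric])
       (use g b x \<gamma> in \<open>auto intro: smooth_vanishing_imp_cont smooth_vanishing_bessel_op\<close>)
  also have "\<dots> = bessel_frac_integral \<nu> (\<gamma> + real k) ?g x"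
    by (rule bessel_frac_integral_cong[OF _ x]) (simp add: bessel_frac_integral_1_bessel_op_smooth[OF g b])
  also note Suc.IH
  finally show ?case .
qed simp

text \<open>Independence of the fractional derivative from its auxiliary integer, with the powers of
  B already moved inside the integral.\<close>

lemma bessel_frac_integral_bessel_op_funpow_eq:
  assumes f: "smooth_vanishing b f" and b: "b > 0" and x: "x > 0"
    and m: "real m > \<alpha>" and n: "real n > \<alpha>"
  shows "bessel_frac_integral \<nu> (real m - \<alpha>) ((bessel_op \<nu> ^^ m) f) x =
    bessel_frac_integral \<nu> (real n - \<alpha>) ((bessel_op \<nu> ^^ n) f) x"
  using m n
proof (induction m n rule: linorder_wlog)
  case (le m n)
  define k where "k = n - m"
  have n: "n = k + m" using le by (simp add: k_def)
  have "bessel_frac_integral \<nu> (real n - \<alpha>) ((bessel_op \<nu> ^^ n) f) x =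
      bessel_frac_integral \<nu> ((real m - \<alpha>) + real k) ((bessel_op \<nu> ^^ k) ((bessel_op \<nu> ^^ m) f)) x"
    by (simp add: n funpow_add algebra_simps)
  also have "\<dots> = bessel_frac_integral \<nu> (real m - \<alpha>) ((bessel_op \<nu> ^^ m) f) x"
    by (rule bessel_frac_integral_add_nat_bessel_op_funpow)
       (use f b x le in \<open>auto intro: smooth_vanishing_bessel_op_funpow\<close>)
  finally show ?case ..
qed simp

text \<open>Moving every power of B inside and merging the integrals leaves l + m copies of B on the
  left and n on the right. Both integers exceed \<alpha> + \<beta>, so the independence of the
  auxiliary integer identifies the two sides.\<close>

theorem bessel_frac_deriv_semigroup:
  assumes f: "smooth_vanishing b f" and b: "b > 0" and x: "x > 0"
    and l: "real l > \<alpha>" and m: "real m > \<beta>" and n: "real n > \<alpha> + \<beta>"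
  shows "bessel_frac_deriv \<nu> l \<alpha> (bessel_frac_deriv \<nu> m \<beta> f) x = bessel_frac_deriv \<nu> n (\<alpha> + \<beta>) f x"
proof -
  let ?I = "bessel_frac_integral \<nu>" and ?B = "\<lambda>n. bessel_op \<nu> ^^ n"
  have Bm: "smooth_vanishing b (?B m f)" by (rule smooth_vanishing_bessel_op_funpow[OF f])
  have inner: "?I (real l - \<alpha>) (?B m (?I (real m - \<beta>) f)) y = ?I (real (l + m) - (\<alpha> + \<beta>)) (?B m f) y"
    if y: "y > 0" for y
  proof -
    have "?I (real l - \<alpha>) (?B m (?I (real m - \<beta>) f)) y = ?I (real l - \<alpha>) (?I (real m - \<beta>) (?B m f)) y"
      by (rule bessel_frac_integral_cong[OF bessel_op_funpow_bessel_frac_integral_commute[OF f b] y])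
         (use m in auto)
    also have "\<dots> = ?I ((real l - \<alpha>) + (real m - \<beta>)) (?B m f) y"
      by (rule bessel_frac_integral_semigroup[OF smooth_vanishing_imp_cont[OF Bm] b _ _ y]) (use l m in auto)
    also have "(real l - \<alpha>) + (real m - \<beta>) = real (l + m) - (\<alpha> + \<beta>)" by simp
    finally show ?thesis .
  qed
  have lm: "real (l + m) > \<alpha> + \<beta>" using l m by simp
  have "bessel_frac_deriv \<nu> l \<alpha> (bessel_frac_deriv \<nu> m \<beta> f) x
      = ?B l (?I (real (l + m) - (\<alpha> + \<beta>)) (?B m f)) x"
    unfolding bessel_frac_deriv_def by (rule bessel_op_funpow_cong[OF inner x])
  also have "\<dots> = ?I (real (l + m) - (\<alpha> + \<beta>)) (?B l (?B m f)) x"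
    by (rule bessel_op_funpow_bessel_frac_integral_commute[OF Bm b _ x]) (use lm in simp)
  also have "?B l (?B m f) = ?B (l + m) f" by (simp add: funpow_add)
  also have "?I (real (l + m) - (\<alpha> + \<beta>)) (?B (l + m) f) x = ?I (real n - (\<alpha> + \<beta>)) (?B n f) x"
    by (rule bessel_frac_integral_bessel_op_funpow_eq[OF f b x lm n])
  also have "\<dots> = bessel_frac_deriv \<nu> n (\<alpha> + \<beta>) f x"
    unfolding bessel_frac_deriv_def
    by (rule bessel_op_funpow_bessel_frac_integral_commute[OF f b _ x, symmetric]) (use n in simp)
  finally show ?thesis .
qed

theorem mainTheorem7:
  fixes \<nu> \<alpha> \<beta> a b :: real and f :: "real \<Rightarrow> real"
  assumes "\<nu> \<ge> 0" and "\<alpha> > 0" and "\<beta> > 0"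
    and "0 < a" and "a < b"
    and "smooth_on_halfline f"
    and "closure (support_on {0<..} f) = {a..b}"
  shows "(\<forall>x>0. bessel_frac_integral \<nu> \<alpha> (bessel_frac_integral \<nu> \<beta> f) x
                = bessel_frac_integral \<nu> (\<alpha> + \<beta>) f x) \<and>
         (\<forall>l m n. real l > \<alpha> \<longrightarrow> real m > \<beta> \<longrightarrow> real n > \<alpha> + \<beta> \<longrightarrow>
           (\<forall>x>0. bessel_frac_deriv \<nu> l \<alpha> (bessel_frac_deriv \<nu> m \<beta> f) x
                  = bessel_frac_deriv \<nu> n (\<alpha> + \<beta>) f x))"
proof -
  have b: "b > 0" using assms by simp
  have "f y = 0" if "y > b" for y
  proof (rule ccontr)
    assume "f y \<noteq> 0"
    then have "y \<in> support_on {0<..} f" using that b by (simp add: support_on_def)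
    then have "y \<in> {a..b}" using closure_subset assms(7) by blast
    with that show False by simp
  qed
  then have f: "smooth_vanishing b f" using assms by (simp add: smooth_vanishing_def)
  show ?thesis
    using bessel_frac_integral_semigroup[OF smooth_vanishing_imp_cont[OF f] b \<open>\<alpha> > 0\<close> \<open>\<beta> > 0\<close>]
      bessel_frac_deriv_semigroup[OF f b] by blast
qed

end
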